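(* Let $p$ be an odd prime. Then the Laurent series $\Theta_p(t)\in\mathbb{F}_p(\!(t^{-1})\!)$ exhibits exactly $\frac{2}{p}$ escape of mass with respect to the sequence $\{t^k\}_{k\ge 0}$.
   Context: The $p$-Cantor sequence: let $p$ be an odd prime, $p_2=\frac{p-1}{2}$, and identify the alphabet $\{0,1,\dots,p-1\}$ with $\mathbb{F}_p$. Define the substitution $\phi_p$ sending each letter $n\in\mathbb{F}_p$ to the word $\phi_p(n)=\phi_p(n)_0\phi_p(n)_1\cdots\phi_p(n)_{p-1}$ of length $p$, where $\phi_p(n)_i=n\cdot\binom{p_2}{i/2}\bmod p$ if $i$ is even and $\phi_p(n)_i=0$ if $i$ is odd; $\phi_p$ acts on words by concatenating images of letters. The $p$-Cantor sequence $(c^{(p)}_i)_{i\ge0}$ over $\mathbb{F}_p$ is $\lim_{n\to\infty}\phi_p^n(1)$, and $\Theta_p(t):=t^{-1}\sum_{i=0}^\infty c^{(p)}_i t^{-i}$. Escape of mass: for a quadratic irrational $\Theta\in\mathbb{F}_q(\!(t^{-1})\!)$ and an irreducible $P\in\mathbb{F}_q[t]$, each $\Theta\cdot P^k$ is a quadratic irrational, so its continued fraction expansion (with polynomial partial quotients of degree $\ge1$ after the zeroth) is eventually periodic; let $\ell_{\Theta P^k}$ be the length of the period and $A_1^{[\Theta P^k]},\dots,A_{\ell_{\Theta P^k}}^{[\Theta P^k]}$ the partial quotients of one period. Set $R_{k,n}=\frac{\sum_{i=1}^{\ell_{\Theta P^k}}\max\{\deg A_i^{[\Theta P^k]}-n,0\}}{\sum_{i=1}^{\ell_{\Theta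 P^k}}\deg A_i^{[\Theta P^k]}}$. For $0<c\le1$, $\Theta$ exhibits $c$ escape of mass with respect to $\{P^k\}_{k\ge0}$ if $\lim_{n\to\infty}\liminf_{k\to\infty}R_{k,n}\ge c$; it exhibits exactly $c$ escape of mass if $c$ is the maximal such value. *)

theory Defs
  imports "HOL-Analysis.Analysis" "HOL-Computational_Algebra.Computational_Algebra"
begin

text \<open>Laurent series in t^{-1} over a field are modelled by 'a fls with the
 formal variable X standing for t^{-1}; so t = fls_X_inv.\<close>

definition cantor_phi_letter :: "nat \<Rightarrow> 'a::field \<Rightarrow> 'a list" where
  "cantor_phi_letter p n =
     map (\<lambda>i. if even i then n * of_nat (((p - 1) div 2) choose (i div 2)) else 0) [0..<p]"

definition cantor_phi :: "nat \<Rightarrow> 'a::field list \<Rightarrow> 'a list" where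
  "cantor_phi p w = concat (map (cantor_phi_letter p) w)"

text \<open>phi^n(1) is a prefix of phi^(n+1)(1) and has length p^n > n, so the i-th letter of the
 limit word equals the i-th letter of phi^(i+1)(1).\<close>
definition cantor_seq :: "nat \<Rightarrow> nat \<Rightarrow> 'a::field" where
  "cantor_seq p i = ((cantor_phi p ^^ Suc i) [1]) ! i"

definition Theta :: "nat \<Rightarrow> 'a::field fls" where
  "Theta p = fls_X * fps_to_fls (Abs_fps (cantor_seq p))"

definition poly_to_tls :: "'a::field poly \<Rightarrow> 'a fls" where
  "poly_to_tls q = (\<Sum>i\<le>degree q. fls_const (coeff q i) * fls_X_inv ^ i)"

definition tls_poly_part :: "'a::field fls \<Rightarrow> 'a poly" where
  "tls_poly_part f = Poly (map (\<lambda>i. fls_nth f (- int i)) [0..<Suc (nat (- fls_subdegree f))])"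

fun cf_rem :: "'a::field fls \<Rightarrow> nat \<Rightarrow> 'a fls" where
  "cf_rem x 0 = x"
| "cf_rem x (Suc n) = inverse (cf_rem x n - poly_to_tls (tls_poly_part (cf_rem x n)))"

definition cf_pq :: "'a::field fls \<Rightarrow> nat \<Rightarrow> 'a poly" where
  "cf_pq x n = tls_poly_part (cf_rem x n)"

definition cf_eventually_periodic :: "'a::field fls \<Rightarrow> bool" where
  "cf_eventually_periodic x \<longleftrightarrow> (\<exists>l>0. \<exists>N. \<forall>n\<ge>N. cf_pq x (n + l) = cf_pq x n)"

definition cf_period :: "'a::field fls \<Rightarrow> nat" where
  "cf_period x = (LEAST l. l > 0 \<and> (\<exists>N. \<forall>n\<ge>N. cf_pq x (n + l) = cf_pq x n))"

definition cf_preperiod :: "'a::field fls \<Rightarrow> nat" where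
  "cf_preperiod x = (LEAST N. \<forall>n\<ge>N. cf_pq x (n + cf_period x) = cf_pq x n)"

definition cf_period_indices :: "'a::field fls \<Rightarrow> nat set" where
  "cf_period_indices x = {Suc (cf_preperiod x) ..< Suc (cf_preperiod x) + cf_period x}"

definition escape_ratio :: "'a::field fls \<Rightarrow> 'a poly \<Rightarrow> nat \<Rightarrow> nat \<Rightarrow> real" where
  "escape_ratio \<Theta> P k n =
     (let y = \<Theta> * poly_to_tls (P ^ k) in
       (\<Sum>i\<in>cf_period_indices y. real (degree (cf_pq y i) - n))
       / (\<Sum>i\<in>cf_period_indices y. real (degree (cf_pq y i))))"

definition exhibits_escape_of_mass :: "'a::field fls \<Rightarrow> 'a poly \<Rightarrow> real \<Rightarrow> bool" where
  "exhibits_escape_of_mass \<Theta> P c \<longleftrightarrow> 0 < c \<and> c \<le> 1 \<and>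
     (\<exists>L. ((\<lambda>n. liminf (\<lambda>k. ereal (escape_ratio \<Theta> P k n))) \<longlonglongrightarrow> L) \<and> ereal c \<le> L)"

definition exhibits_exactly_escape_of_mass :: "'a::field fls \<Rightarrow> 'a poly \<Rightarrow> real \<Rightarrow> bool" where
  "exhibits_exactly_escape_of_mass \<Theta> P c \<longleftrightarrow>
     exhibits_escape_of_mass \<Theta> P c \<and> (\<forall>c'. exhibits_escape_of_mass \<Theta> P c' \<longrightarrow> c' \<le> c)"

end

theory Submission
  imports Defs
begin

text \<open>Reading off the substitution gives $C(X) = C(X^p)\,(1 + X^2)^{(p-1)/2}$ for the generating
  series $C$ of the Cantor sequence, so $Z = C^2(1 + X^2)$ satisfies $Z(X) = Z(X^p)$, hence $Z = 1$
  and $\Theta_p = 1/\sqrt{t^2 + 1}$. Let $w = \sqrt{t^2+1}$ and $u = t + w$. A coprime pair $(P, Q)$ for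
  which $t^k Q - P w$ is small at one infinite place is a convergent of $t^k/w$ whose following
  partial quotient has degree $k + 1$ minus the width of $t^k Q - P w$ as a Laurent polynomial
  in $u$. Let $s = p^j < k \le ps = q$; by Frobenius the first coordinates of $u^s$ and $u^q$ are
  $t^s$ and $t^q$, and the expansion has period $2q$ measured in degrees of denominators.

  The elements $u^q$ and $w$ (times powers of $u^{2q}$) give partial quotients of degrees
  $k + 1$ and $k - 1$, and for $k \le 2s$ the elements $t^{k-s}u^{\pm s}$ give two more of degree
  $2s - k + 1$. The sum is at least $4s$ out of $2ps$, a proportion of $2/p$. For $k = 2s - 1$
  the elements $((1 + h)u^a - hu^{a+2s} - u^{2sh-a})/t$ exhibit partial quotients of degree $2$ of
  total degree $2(p-2)(s-1)$, so at most a proportion tending to $2/p$ escapes.\<close>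

section \<open>Polynomials as Laurent series\<close>

lemma poly_to_tls_nth:
  "fls_nth (poly_to_tls q) i = (if i \<le> 0 then coeff q (nat (- i)) else 0)"
proof -
  have "fls_nth (poly_to_tls q) i = (\<Sum>j\<le>degree q. coeff q j * (if i = - int j then 1 else 0))"
    by (simp add: poly_to_tls_def fls_nth_sum)
  also have "\<dots> = (\<Sum>j\<le>degree q. if j = nat (- i) then (if i \<le> 0 then coeff q (nat (- i)) else 0) else 0)"
    by (intro sum.cong) auto
  also have "\<dots> = (if i \<le> 0 then coeff q (nat (- i)) else 0)"
    by (auto simp: sum.delta coeff_eq_0)
  finally show ?thesis .
qed

lemma poly_to_tls_0 [simp]: "poly_to_tls 0 = 0"
  by (simp add: poly_to_tls_def)

lemma poly_to_tls_add: "poly_to_tls (p + q) = poly_to_tls p + poly_to_tls q"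
  by (rule fls_eqI) (simp add: poly_to_tls_nth)

lemma poly_to_tls_diff: "poly_to_tls (p - q) = poly_to_tls p - poly_to_tls q"
  by (rule fls_eqI) (simp add: poly_to_tls_nth)

lemma poly_to_tls_smult: "poly_to_tls (smult c q) = fls_const c * poly_to_tls q"
  by (rule fls_eqI) (simp add: poly_to_tls_nth)

lemma poly_to_tls_pCons: "poly_to_tls (pCons a q) = fls_const a + fls_X_inv * poly_to_tls q"
proof (rule fls_eqI)
  fix i :: int
  show "fls_nth (poly_to_tls (pCons a q)) i = fls_nth (fls_const a + fls_X_inv * poly_to_tls q) i"
  proof (cases "i < 0")
    case True
    then have "nat (- i) = Suc (nat (- (i + 1)))"
      by simp
    with True show ?thesis
      by (simp add: poly_to_tls_nth fls_X_inv_times_conv_shift)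
  qed (auto simp: poly_to_tls_nth fls_X_inv_times_conv_shift)
qed

lemma poly_to_tls_mult: "poly_to_tls (p * q) = poly_to_tls p * poly_to_tls q"
  by (induction p)
    (simp_all add: poly_to_tls_add poly_to_tls_smult poly_to_tls_pCons algebra_simps)

lemma poly_to_tls_1 [simp]: "poly_to_tls 1 = 1"
  by (simp add: one_pCons poly_to_tls_pCons)

lemma poly_to_tls_power: "poly_to_tls (q ^ n) = poly_to_tls q ^ n"
  by (induction n) (simp_all add: poly_to_tls_mult)

lemma poly_to_tls_eq_iff [simp]: "poly_to_tls p = poly_to_tls q \<longleftrightarrow> p = q"
proof
  assume eq: "poly_to_tls p = poly_to_tls q"
  show "p = q"
  proof (rule poly_eqI)
    fix n
    show "coeff p n = coeff q n"
      using arg_cong[OF eq, of "\<lambda>f. fls_nth f (- int n)"] by (simp add: poly_to_tls_nth)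
  qed
qed simp

lemma poly_to_tls_eq_0_iff [simp]: "poly_to_tls q = 0 \<longleftrightarrow> q = 0"
  using poly_to_tls_eq_iff[of q 0] by simp

lemma fls_subdegree_poly_to_tls: "fls_subdegree (poly_to_tls q) = - int (degree q)"
proof (cases "q = 0")
  case False
  show ?thesis
  proof (rule fls_subdegree_eqI)
    show "fls_nth (poly_to_tls q) (- int (degree q)) \<noteq> 0"
      using False by (simp add: poly_to_tls_nth)
    show "fls_nth (poly_to_tls q) i = 0" if "i < - int (degree q)" for i
      using that by (simp add: poly_to_tls_nth coeff_eq_0)
  qed
qed simp

lemma coeff_tls_poly_part: "coeff (tls_poly_part f) n = fls_nth f (- int n)"
proof (cases "n < Suc (nat (- fls_subdegree f))")
  case True
  then show ?thesis
    by (simp add: tls_poly_part_def nth_default_def del: upt_Suc)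
next
  case False
  then have "- int n < fls_subdegree f"
    by linarith
  with False show ?thesis
    by (simp add: tls_poly_part_def nth_default_def del: upt_Suc)
qed

abbreviation tls_frac :: "'a::field fls \<Rightarrow> 'a fls" where
  "tls_frac x \<equiv> x - poly_to_tls (tls_poly_part x)"

lemma fls_subdegree_tls_frac: "tls_frac x \<noteq> 0 \<Longrightarrow> fls_subdegree (tls_frac x) > 0"
  by (rule fls_subdegree_greaterI) (auto simp: poly_to_tls_nth coeff_tls_poly_part)

lemma degree_tls_poly_part:
  assumes "x \<noteq> 0" "fls_subdegree x \<le> 0"
  shows "int (degree (tls_poly_part x)) = - fls_subdegree x"
proof -
  have "fls_subdegree (poly_to_tls (tls_poly_part x)) = fls_subdegree x"
  proof (rule fls_subdegree_eqI)
    show "fls_nth (poly_to_tls (tls_poly_part x)) (fls_subdegree x) \<noteq> 0"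
      using assms by (simp add: poly_to_tls_nth coeff_tls_poly_part)
    show "fls_nth (poly_to_tls (tls_poly_part x)) i = 0" if "i < fls_subdegree x" for i
      using that by (simp add: poly_to_tls_nth coeff_tls_poly_part)
  qed
  then show ?thesis
    by (simp add: fls_subdegree_poly_to_tls)
qed

section \<open>Best approximations\<close>

lemma cf_rem_shift: "cf_rem x (Suc n) = cf_rem (inverse (tls_frac x)) n"
  by (induction n) auto

lemma cf_pq_shift: "cf_pq x (Suc n) = cf_pq (inverse (tls_frac x)) n"
  by (simp only: cf_pq_def cf_rem_shift)

text \<open>Legendre's criterion: over a function field every coprime pair with
  $|Q x - P| < 1/|Q|$ is a convergent. The induction on the degree of $Q$ replaces $x$ by the next
  complete quotient and $P/Q$ by $Q/(P - aQ)$, so convergents never have to be introduced.\<close>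

lemma best_approximation:
  fixes x :: "'a::field fls"
  assumes "coprime P Q" "Q \<noteq> 0" "poly_to_tls Q * x \<noteq> poly_to_tls P" "d > 0"
    and "fls_subdegree (poly_to_tls Q * x - poly_to_tls P) = int (degree Q) + int d"
  shows "\<exists>n. (\<Sum>i=1..n. degree (cf_pq x i)) = degree Q \<and> degree (cf_pq x (Suc n)) = d"
  using assms
proof (induction "degree Q" arbitrary: P Q x rule: less_induct)
  case less
  define L where "L = (poly_to_tls :: 'a poly \<Rightarrow> _)"
  define a where "a = tls_poly_part x"
  define y where "y = tls_frac x"
  define z where "z = L Q * x - L P"
  have z: "z \<noteq> 0" "fls_subdegree z = int (degree Q) + int d"
    using less.prems by (simp_all add: z_def L_def)
  have x: "x = L a + y"
    by (simp add: y_def a_def L_def)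
  have z_eq: "z = L Q * y - L (P - a * Q)"
    by (simp add: z_def x L_def poly_to_tls_diff poly_to_tls_mult algebra_simps)
  have y0: "y \<noteq> 0"
  proof
    assume "y = 0"
    then have "fls_subdegree z = - int (degree (P - a * Q))"
      using z_eq by (simp add: L_def fls_subdegree_poly_to_tls)
    then show False
      using z less.prems(4) by simp
  qed
  define e where "e = nat (fls_subdegree y)"
  have ey: "fls_subdegree y = int e" "e > 0"
    using fls_subdegree_tls_frac[of x] y0 by (simp_all add: e_def y_def)
  define x' where "x' = inverse y"
  have x': "x' \<noteq> 0" "fls_subdegree x' = - int e"
    using y0 ey by (simp_all add: x'_def)
  have pq1: "degree (cf_pq x 1) = e"
    using degree_tls_poly_part[of x'] x'
    by (simp add: cf_pq_def x'_def y_def)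
  show ?case
  proof (cases "P - a * Q = 0")
    \<comment> \<open>Here \<open>P/Q\<close> is the polynomial part of \<open>x\<close>, so
      coprimality makes \<open>Q\<close> constant and the convergent sought is the zeroth.\<close>
    case True
    have "Q dvd P"
      using True by (metis dvd_triv_right eq_iff_diff_eq_0)
    then have "Q dvd 1"
      using less.prems(1) by (meson coprime_common_divisor dvd_refl)
    then have "degree Q = 0"
      using less.prems(2) by (simp add: is_unit_iff_degree)
    moreover have "e = d"
      using z_eq z True ey y0 less.prems(2) \<open>degree Q = 0\<close>
      by (simp add: L_def fls_subdegree_poly_to_tls)
    ultimately have "(\<Sum>i=1..0. degree (cf_pq x i)) = degree Q \<and> degree (cf_pq x (Suc 0)) = d"
      using pq1 by simp
    then show ?thesis
      by blast
  next
    case False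
    define R where "R = P - a * Q"
    have R0: "R \<noteq> 0"
      using False by (simp add: R_def)
    have LR: "L R = L Q * y - z"
      using z_eq by (simp add: R_def)
    have sQy: "fls_subdegree (L Q * y) = int e - int (degree Q)"
      using y0 ey less.prems(2) by (simp add: L_def fls_subdegree_poly_to_tls)
    \<comment> \<open>A polynomial has no terms of positive order in \<open>X\<close>, so if
      \<open>L Q * y\<close> were as small as \<open>z\<close>, the nonzero \<open>R\<close> would
      have to vanish.\<close>
    have "fls_subdegree (L Q * y) < fls_subdegree z"
    proof (rule ccontr)
      assume "\<not> ?thesis"
      then have "fls_nth (L R) i = 0" if "i \<le> 0" for i
        using that z(2) less.prems(4) by (simp add: LR)
      then have "fls_subdegree (L R) > 0"
        using R0 by (intro fls_subdegree_greaterI) (auto simp: L_def)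
      then show False
        using R0 by (simp add: L_def fls_subdegree_poly_to_tls)
    qed
    then have "fls_subdegree (L R) = int e - int (degree Q)"
      using LR sQy y0 less.prems(2) by (simp add: L_def fls_subdegree_diff_eq1)
    then have degQ: "degree Q = e + degree R"
      by (simp add: L_def fls_subdegree_poly_to_tls)
    \<comment> \<open>Dividing by \<open>y\<close> turns the error of \<open>P/Q\<close> for
      \<open>x\<close> into that of \<open>Q/R\<close> for \<open>x'\<close>; its excess
      \<open>d\<close> over the degree of the denominator is unchanged.\<close>
    have "L R * x' - L Q = - (z * x')"
      unfolding LR x'_def using y0 by (simp add: algebra_simps)
    then have neq: "L R * x' \<noteq> L Q"
      and sd: "fls_subdegree (L R * x' - L Q) = int (degree R) + int d"
      using z x' degQ by auto
    have cop: "coprime Q R"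
    proof (rule coprimeI)
      fix c assume c: "c dvd Q" "c dvd R"
      then have "c dvd R + a * Q"
        by (intro dvd_add dvd_mult)
      then have "c dvd P"
        by (simp add: R_def)
      with c(1) less.prems(1) show "c dvd 1"
        by (meson coprime_common_divisor)
    qed
    obtain n where n: "(\<Sum>i=1..n. degree (cf_pq x' i)) = degree R" "degree (cf_pq x' (Suc n)) = d"
      using less.hyps[of R Q x'] cop R0 neq less.prems(4) sd degQ ey(2) by (auto simp: L_def)
    have "(\<Sum>i=1..Suc n. degree (cf_pq x i)) = degree (cf_pq x 1) + (\<Sum>i=1..n. degree (cf_pq x (Suc i)))"
      by (simp add: sum.shift_bounds_cl_Suc_ivl sum.atLeast_Suc_atMost del: sum.cl_ivl_Suc)
    also have "\<dots> = degree Q"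
      using n pq1 degQ by (simp add: cf_pq_shift x'_def y_def)
    finally show ?thesis
      using n(2) by (metis cf_pq_shift x'_def y_def)
  qed
qed

section \<open>Periodic sequences of degrees\<close>

lemma periodic_add_mult:
  fixes f :: "nat \<Rightarrow> 'b"
  assumes "\<And>i. i \<ge> N \<Longrightarrow> f (i + l) = f i" "i \<ge> N"
  shows "f (i + c * l) = f i"
proof (induction c)
  case (Suc c)
  have "f (i + Suc c * l) = f (i + c * l + l)"
    by (simp add: algebra_simps)
  also have "\<dots> = f i"
    using Suc assms by simp
  finally show ?case .
qed simp

lemma sum_periodic:
  fixes f :: "nat \<Rightarrow> nat"
  assumes per: "\<And>i. i \<ge> N \<Longrightarrow> f (i + l) = f i"
  shows "(\<Sum>j\<in>{N + c * l..<N + c * l + e * l}. f j) = e * (\<Sum>j\<in>{N..<N + l}. f j)"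
proof (induction e)
  case (Suc e)
  have "(\<Sum>j\<in>{N + c * l..<N + c * l + Suc e * l}. f j)
      = (\<Sum>j\<in>{N + c * l..<N + c * l + e * l}. f j)
        + (\<Sum>j\<in>{N + c * l + e * l..<N + c * l + e * l + l}. f j)"
    by (subst sum.atLeastLessThan_concat) (auto simp: algebra_simps)
  also have "(\<Sum>j\<in>{N + c * l + e * l..<N + c * l + e * l + l}. f j)
      = (\<Sum>j\<in>{N + (c + e) * l..<N + l + (c + e) * l}. f j)"
    by (simp add: algebra_simps)
  also have "\<dots> = (\<Sum>j\<in>{N..<N + l}. f (j + (c + e) * l))"
    by (rule sum.shift_bounds_nat_ivl)
  also have "\<dots> = (\<Sum>j\<in>{N..<N + l}. f j)"
    by (intro sum.cong refl periodic_add_mult[of N] per) auto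
  finally show ?case
    using Suc by simp
qed simp

text \<open>A position $\mu + iW$ is a partial sum of the degrees, i.e. the degree of a convergent
  denominator, and $D\mu$ is the degree of the next partial quotient. If such positions are known in
  every window of length $W$, then comparing $W$ periods with as many windows as a period has
  degree bounds the sum over one period, although the length of the period is unknown.\<close>

lemma periodic_sum_ge:
  fixes d \<phi> D :: "nat \<Rightarrow> nat"
  defines "m \<equiv> \<lambda>n. \<Sum>i=1..n. d i"
  assumes per: "\<And>i. i \<ge> Suc N \<Longrightarrow> d (i + l) = d i"
    and A: "A \<subseteq> {..<W}"
    and hit: "\<And>\<mu> i. \<mu> \<in> A \<Longrightarrow> i \<ge> i0 \<Longrightarrow> \<exists>n. m n = \<mu> + i * W \<and> d (Suc n) = D \<mu>"
    and D: "\<And>\<mu>. \<mu> \<in> A \<Longrightarrow> D \<mu> > 0"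
  shows "(\<Sum>j\<in>{Suc N..<Suc N + l}. d j) * (\<Sum>\<mu>\<in>A. \<phi> (D \<mu>))
      \<le> W * (\<Sum>j\<in>{Suc N..<Suc N + l}. \<phi> (d j))"
proof (cases "(\<Sum>j\<in>{Suc N..<Suc N + l}. d j) = 0 \<or> W = 0")
  case True
  then show ?thesis
    using A by auto
next
  case False
  define S where "S = (\<Sum>j\<in>{Suc N..<Suc N + l}. d j)"
  have S: "S > 0" and W: "W > 0"
    using False by (auto simp: S_def)
  \<comment> \<open>A period has degree at least 1, so after \<open>c\<close> of them the partial
    sum is past the windows with index below \<open>i0\<close>, about which \<open>hit\<close> says
    nothing.\<close>
  define c where "c = i0 * W + W"
  define M where "M = N + c * l"
  have m_split: "m (a + b) = m a + (\<Sum>j\<in>{Suc a..<Suc a + b}. d j)" for a b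
    using sum.atLeastLessThan_concat[of 1 "Suc a" "Suc a + b" d]
    by (simp add: m_def flip: atLeastLessThanSuc_atLeastAtMost del: sum.op_ivl_Suc)
  have mono_m: "m a \<le> m b" if "a \<le> b" for a b
    using m_split[of a "b - a"] that by simp
  have "m M = m N + c * S"
    using m_split[of N "c * l"] sum_periodic[of "Suc N" d l 0 c] per by (simp add: M_def S_def)
  then have mM: "m M \<ge> i0 * W + W"
    using S by (simp add: c_def trans_le_add2)
  \<comment> \<open>\<open>W\<close> periods have total degree \<open>W * S\<close>, which is
    exactly \<open>S\<close> windows of length \<open>W\<close>.\<close>
  have mMW: "m (M + W * l) = m M + W * S"
    using m_split[of M "W * l"] sum_periodic[of "Suc N" d l c W] per by (simp add: M_def S_def)
  have ex_i: "\<exists>i\<ge>i0. m M \<le> \<mu> + i * W \<and> \<mu> + i * W < m M + W" if "\<mu> \<in> A" for \<mu>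
  proof -
    have \<mu>: "\<mu> < W" using A that by auto
    \<comment> \<open>A ceiling division: the first window index that brings \<open>\<mu>\<close> up
      to \<open>m M\<close>.\<close>
    define i where "i = (m M - \<mu> + (W - 1)) div W"
    have eq: "i * W + (m M - \<mu> + (W - 1)) mod W = m M - \<mu> + (W - 1)"
      by (simp add: i_def)
    have less: "(m M - \<mu> + (W - 1)) mod W < W"
      using W by simp
    have *: "m M \<le> \<mu> + i * W" "\<mu> + i * W < m M + W"
      using eq less \<mu> mM by linarith+
    have "i0 \<le> i"
    proof (rule ccontr)
      assume "\<not> i0 \<le> i"
      then have "i * W \<le> i0 * W"
        by simp
      with * \<mu> mM show False
        by linarith
    qed
    with * show ?thesis by blast
  qed
  then obtain \<iota> where \<iota>: "\<And>\<mu>. \<mu> \<in> A \<Longrightarrow> \<iota> \<mu> \<ge> i0 \<and> m M \<le> \<mu> + \<iota> \<mu> * W \<and> \<mu> + \<iota> \<mu> * W < m M + W"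
    by metis
  have "\<exists>n. m n = \<mu> + (\<iota> \<mu> + e) * W \<and> d (Suc n) = D \<mu>" if "\<mu> \<in> A" for \<mu> e
    using hit[OF that, of "\<iota> \<mu> + e"] \<iota>[OF that] by auto
  then obtain g where g: "\<And>\<mu> e. \<mu> \<in> A \<Longrightarrow> m (g \<mu> e) = \<mu> + (\<iota> \<mu> + e) * W \<and> d (Suc (g \<mu> e)) = D \<mu>"
    by metis
  define h where "h = (\<lambda>(\<mu>, e). Suc (g \<mu> e))"
  define I where "I = {Suc M..<Suc M + W * l}"
  have finA: "finite A"
    using A finite_subset by blast
  have range: "h ` (A \<times> {..<S}) \<subseteq> I"
  proof (clarsimp simp: h_def I_def)
    fix \<mu> e assume \<mu>: "\<mu> \<in> A" and e: "e < S"
    have "Suc e * W \<le> S * W"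
      using e by (intro mult_le_mono1) simp
    then have 1: "m (g \<mu> e) < m (M + W * l)"
      using \<iota>[OF \<mu>] g[OF \<mu>, of e] mMW by (simp add: algebra_simps)
    have 2: "m M \<le> m (g \<mu> e)"
      using \<iota>[OF \<mu>] g[OF \<mu>, of e] by (simp add: algebra_simps)
    have 3: "m (Suc (g \<mu> e)) > m (g \<mu> e)"
      using m_split[of "g \<mu> e" 1] g[OF \<mu>, of e] D[OF \<mu>] by simp
    show "M \<le> g \<mu> e \<and> g \<mu> e < M + W * l"
      using mono_m[of "Suc (g \<mu> e)" M] mono_m[of "M + W * l" "g \<mu> e"] 1 2 3
      by (meson leD leI less_eq_Suc_le order_less_le_trans)
  qed
  have inj: "inj_on h (A \<times> {..<S})"
  proof (rule inj_onI, clarsimp simp: h_def)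
    fix \<mu> e \<nu> f
    assume *: "\<mu> \<in> A" "\<nu> \<in> A" "g \<mu> e = g \<nu> f"
    then have eq: "\<mu> + (\<iota> \<mu> + e) * W = \<nu> + (\<iota> \<nu> + f) * W"
      using g by metis
    then have "(\<mu> + (\<iota> \<mu> + e) * W) mod W = (\<nu> + (\<iota> \<nu> + f) * W) mod W"
      by simp
    then have "\<mu> = \<nu>"
      using * A by (auto simp: subset_iff)
    with eq W show "\<mu> = \<nu> \<and> e = f"
      by simp
  qed
  have "S * (\<Sum>\<mu>\<in>A. \<phi> (D \<mu>)) = (\<Sum>\<mu>\<in>A. \<Sum>e<S. \<phi> (D \<mu>))"
    by (simp add: sum_distrib_left)
  also have "\<dots> = (\<Sum>x\<in>A \<times> {..<S}. \<phi> (d (h x)))"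
    unfolding sum.cartesian_product using g by (intro sum.cong) (auto simp: h_def)
  also have "\<dots> = (\<Sum>j\<in>h ` (A \<times> {..<S}). \<phi> (d j))"
    by (simp add: sum.reindex[OF inj])
  also have "\<dots> \<le> (\<Sum>j\<in>I. \<phi> (d j))"
    using range by (intro sum_mono2) (auto simp: I_def)
  also have "\<dots> = W * (\<Sum>j\<in>{Suc N..<Suc N + l}. \<phi> (d j))"
    using sum_periodic[of "Suc N" "\<lambda>j. \<phi> (d j)" l c W] per by (simp add: M_def I_def)
  finally show ?thesis
    by (simp add: S_def)
qed

text \<open>A zero sum would kill all degrees beyond \<open>N\<close> and so bound the partial sums.
  This licenses dividing by the degree of a period.\<close>

lemma periodic_sum_pos:
  fixes d :: "nat \<Rightarrow> nat"
  assumes per: "\<And>i. i \<ge> Suc N \<Longrightarrow> d (i + l) = d i" and l: "l > 0"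
    and unbounded: "\<And>B. \<exists>n. (\<Sum>i=1..n. d i) > B"
  shows "(\<Sum>j\<in>{Suc N..<Suc N + l}. d j) > 0"
proof (rule ccontr)
  assume "\<not> ?thesis"
  then have "\<forall>j\<in>{Suc N..<Suc N + l}. d j = 0"
    by (simp add: sum_eq_0_iff del: sum.op_ivl_Suc)
  then have zero: "d j = 0" if "j \<in> {Suc N..<Suc N + l}" for j
    using that by blast
  have zero': "d j = 0" if "j > N" for j
  proof -
    have "d j = d (Suc N + (j - Suc N) mod l + (j - Suc N) div l * l)"
      using that by simp
    also have "\<dots> = d (Suc N + (j - Suc N) mod l)"
      by (rule periodic_add_mult[of "Suc N"]) (use per in auto)
    also have "\<dots> = 0"
      using l by (intro zero) simp
    finally show ?thesis .
  qed
  have "(\<Sum>i=1..n. d i) \<le> (\<Sum>i=1..N. d i)" for n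
  proof -
    have "(\<Sum>i=1..n. d i) = (\<Sum>i\<in>{1..n} \<inter> {1..N}. d i)"
      by (intro sum.mono_neutral_right) (auto intro!: zero')
    also have "\<dots> \<le> (\<Sum>i=1..N. d i)"
      by (intro sum_mono2) auto
    finally show ?thesis .
  qed
  with unbounded show False
    by (meson leD)
qed

section \<open>Quadratic irrationals over a finite field\<close>

lemma finite_polys_degree_le: "finite {q :: 'a::{field,finite} poly. degree q \<le> n}"
proof (rule finite_subset)
  show "{q :: 'a poly. degree q \<le> n} \<subseteq> Poly ` {xs. set xs \<subseteq> UNIV \<and> length xs \<le> Suc n}"
  proof
    fix q :: "'a poly" assume "q \<in> {q. degree q \<le> n}"
    then show "q \<in> Poly ` {xs. set xs \<subseteq> UNIV \<and> length xs \<le> Suc n}"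
      by (intro image_eqI[of _ _ "coeffs q"]) (cases "q = 0"; simp add: length_coeffs_degree)+
  qed
qed (use finite_lists_length_le[of "UNIV :: 'a set" "Suc n"] in auto)

text \<open>The complete quotients are the classical $(P + E)/Q$ with $Q$ dividing $E^2 - P^2$ and
  bounded degrees; $0$ is the junk value $1/0$ reached if the expansion terminates.\<close>

lemma cf_eventually_periodic_sqrt:
  fixes E x :: "'a::{field,finite} fls"
  assumes two: "(2 :: 'a) \<noteq> 0"
    and E: "E ^ 2 = poly_to_tls \<Delta>" "fls_subdegree E = - int e" "e > 0"
    and x: "x * poly_to_tls Q0 = poly_to_tls P0 + E"
    and Q0: "Q0 \<noteq> 0" "degree Q0 \<le> e" "Q0 dvd \<Delta> - P0 ^ 2" and P0: "degree P0 \<le> e"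
  shows "cf_eventually_periodic x"
proof -
  define B where "B = {x. \<exists>P Q. Q \<noteq> 0 \<and> degree Q \<le> e \<and> degree P \<le> e \<and> Q dvd \<Delta> - P ^ 2
      \<and> x * poly_to_tls Q = poly_to_tls P + E}"
  define L where "L = (poly_to_tls :: 'a poly \<Rightarrow> _)"
  have "finite B"
  proof (rule finite_subset)
    show "B \<subseteq> (\<lambda>(P, Q). (L P + E) / L Q) ` ({q. degree q \<le> e} \<times> {q. degree q \<le> e})"
    proof
      fix x assume "x \<in> B"
      then obtain P Q where "Q \<noteq> 0" "degree Q \<le> e" "degree P \<le> e" "x * L Q = L P + E"
        by (auto simp: B_def L_def)
      then show "x \<in> (\<lambda>(P, Q). (L P + E) / L Q) ` ({q. degree q \<le> e} \<times> {q. degree q \<le> e})"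
        by (intro image_eqI[of _ _ "(P, Q)"]) (auto simp: L_def eq_divide_eq)
    qed
  qed (simp add: finite_polys_degree_le)
  have E0: "E \<noteq> 0"
    using E by auto
  have step: "inverse (tls_frac x) \<in> insert 0 B" if xB: "x \<in> insert 0 B" for x
  proof (cases "x = 0 \<or> tls_frac x = 0")
    case True
    then show ?thesis
      by (auto simp: tls_poly_part_def Poly_eq_0 poly_to_tls_def)
  next
    case False
    then obtain P Q where PQ: "Q \<noteq> 0" "degree Q \<le> e" "degree P \<le> e" "Q dvd \<Delta> - P ^ 2"
      "x * L Q = L P + E"
      using xB by (auto simp: B_def L_def)
    define a where "a = tls_poly_part x"
    define y where "y = tls_frac x"
    have y: "y \<noteq> 0" "fls_subdegree y > 0"
      using False fls_subdegree_tls_frac[of x] by (auto simp: y_def)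
    have xa: "x = L a + y"
      by (simp add: y_def a_def L_def)
    \<comment> \<open>The classical recursion: \<open>P'\<close> is the next numerator, and the
      cofactor \<open>Q'\<close> of \<open>Q\<close> in \<open>\<Delta> - P' ^ 2\<close> is the next
      denominator.\<close>
    define P' where "P' = a * Q - P"
    have yQ: "y * L Q = E - L P'"
      using PQ(5) by (simp add: xa P'_def L_def poly_to_tls_diff poly_to_tls_mult algebra_simps)
    have "Q dvd \<Delta> - P' ^ 2"
    proof -
      have "\<Delta> - P' ^ 2 = (\<Delta> - P ^ 2) + Q * (2 * a * P - a * a * Q)"
        by (simp add: P'_def power2_eq_square algebra_simps)
      with PQ(4) show ?thesis
        by (metis dvd_add dvd_triv_left)
    qed
    then obtain Q' where Q': "\<Delta> - P' ^ 2 = Q * Q'"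
      by blast
    have "L Q * L Q' = L \<Delta> - L P' ^ 2"
      unfolding L_def using Q' by (metis poly_to_tls_diff poly_to_tls_mult poly_to_tls_power)
    also have "\<dots> = (E - L P') * (E + L P')"
      using E(1) by (simp add: L_def power2_eq_square algebra_simps)
    finally have "L Q * L Q' = L Q * (y * (E + L P'))"
      by (simp only: yQ[symmetric]) (simp only: ac_simps)
    then have Q'_eq: "L Q' = y * (E + L P')"
      using PQ(1) by (simp add: L_def)
    \<comment> \<open>Consequently \<open>P'\<close> shares its leading term with \<open>E\<close>,
      and \<open>E + P'\<close> has the order of \<open>2 * E\<close>; this is where characteristic
      2 is excluded.\<close>
    have sd: "fls_subdegree (y * L Q) > fls_subdegree E"
      using y PQ(1,2) E(2) by (simp add: L_def fls_subdegree_poly_to_tls)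
    have "L P' = E - y * L Q"
      using yQ by simp
    then have sdP': "fls_subdegree (L P') = - int e"
      using sd E E0 by (simp add: fls_subdegree_diff_eq1)
    have "fls_subdegree (2 * E) = - int e" "2 * E \<noteq> 0"
    proof -
      have "(2 :: 'a fls) = fls_const 2"
        by simp
      then have "(2 :: 'a fls) \<noteq> 0" "fls_subdegree (2 :: 'a fls) = 0"
        using two by (metis fls_const_eq_0_iff, simp)
      then show "fls_subdegree (2 * E) = - int e" "2 * E \<noteq> 0"
        using E E0 by auto
    qed
    moreover have EP': "E + L P' = 2 * E - y * L Q"
      using yQ by simp
    moreover have "2 * E \<noteq> y * L Q"
      using calculation(1) sd E(2) by (metis less_irrefl)
    ultimately have sdEP: "E + L P' \<noteq> 0" "fls_subdegree (E + L P') = - int e"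
      using sd E(2) by (simp_all add: fls_subdegree_diff_eq1 del: fls_subdegree_mult)
    have "inverse y * L Q' = L P' + E"
      using y by (simp add: Q'_eq algebra_simps)
    moreover have "Q' \<noteq> 0"
      using Q'_eq y sdEP by (auto simp: L_def)
    moreover have "degree P' \<le> e"
      using sdP' by (simp add: L_def fls_subdegree_poly_to_tls)
    moreover have "degree Q' \<le> e"
    proof -
      have "fls_subdegree (L Q') = fls_subdegree y - int e"
        using Q'_eq y sdEP by simp
      then show ?thesis
        using y by (simp add: L_def fls_subdegree_poly_to_tls)
    qed
    moreover have "Q' dvd \<Delta> - P' ^ 2"
      using Q' by simp
    ultimately have "inverse y \<in> B"
      unfolding B_def L_def by blast
    then show ?thesis
      by (simp add: y_def)
  qed
  have "x \<in> B"
    unfolding B_def using assms by blast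
  then have "cf_rem x n \<in> insert 0 B" for n
    by (induction n) (use step in auto)
  then have "range (cf_rem x) \<subseteq> insert 0 B"
    by blast
  then have "finite (range (cf_rem x))"
    using \<open>finite B\<close> finite_subset by blast
  then have "\<not> inj (cf_rem x)"
    using finite_imageD by blast
  then obtain i j where ij: "i < j" "cf_rem x i = cf_rem x j"
    by (metis injI linorder_neqE_nat)
  have "cf_rem x (i + n + (j - i)) = cf_rem x (i + n)" for n
    by (induction n) (use ij in auto)
  then have "cf_pq x (n + (j - i)) = cf_pq x n" if "n \<ge> i" for n
    using that by (metis cf_pq_def le_add_diff_inverse)
  then show ?thesis
    unfolding cf_eventually_periodic_def using ij(1) by (meson zero_less_diff)
qed

lemma cf_period_indices_periodic:
  assumes "cf_eventually_periodic x"
  shows "cf_period x > 0"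
    and "i \<ge> cf_preperiod x \<Longrightarrow> cf_pq x (i + cf_period x) = cf_pq x i"
proof -
  have *: "cf_period x > 0 \<and> (\<exists>N. \<forall>n\<ge>N. cf_pq x (n + cf_period x) = cf_pq x n)"
    unfolding cf_period_def
    by (rule LeastI_ex) (use assms in \<open>unfold cf_eventually_periodic_def\<close>, blast)
  then show "cf_period x > 0"
    by blast
  have "\<forall>n\<ge>cf_preperiod x. cf_pq x (n + cf_period x) = cf_pq x n"
    unfolding cf_preperiod_def by (rule LeastI_ex) (use * in blast)
  then show "i \<ge> cf_preperiod x \<Longrightarrow> cf_pq x (i + cf_period x) = cf_pq x i"
    by blast
qed

section \<open>The Cantor series\<close>

lemma length_cantor_phi [simp]: "length (cantor_phi p w) = p * length w"
  by (induction w) (simp_all add: cantor_phi_def cantor_phi_letter_def)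

text \<open>The substitution is linear in the letter: every image is a multiple of the image of
  1.\<close>

lemma cantor_phi_nth:
  assumes "i < p * length w"
  shows "cantor_phi p w ! i = w ! (i div p) * cantor_phi_letter p 1 ! (i mod p)"
  using assms
proof (induction w arbitrary: i)
  case (Cons a w)
  have p: "p > 0"
    using Cons.prems by (cases p) auto
  have eq: "cantor_phi p (a # w) = cantor_phi_letter p a @ cantor_phi p w"
    by (simp add: cantor_phi_def)
  have len: "length (cantor_phi_letter p a) = p"
    by (simp add: cantor_phi_letter_def)
  show ?case
  proof (cases "i < p")
    case True
    then show ?thesis
      by (simp add: eq nth_append len) (simp add: cantor_phi_letter_def)
  next
    case False
    then have "i div p = Suc ((i - p) div p)" "i mod p = (i - p) mod p"
      using p by (simp_all add: le_div_geq le_mod_geq)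
    with False Cons.IH[of "i - p"] Cons.prems show ?thesis
      by (simp add: eq nth_append len)
  qed
qed (simp add: cantor_phi_def)

lemma length_cantor_phi_funpow: "length ((cantor_phi p ^^ n) [1]) = p ^ n"
  by (induction n) simp_all

text \<open>The image of 1 begins with 1, so each iterate is a prefix of the next; the induction
  divides the index by \<open>p\<close>.\<close>

lemma cantor_phi_funpow_stable:
  assumes "i < p ^ n" "p > 1"
  shows "(cantor_phi p ^^ Suc n) [1 :: 'a::field] ! i = (cantor_phi p ^^ n) [1] ! i"
  using assms(1)
proof (induction n arbitrary: i)
  case 0
  then show ?case
    using assms(2) by (simp add: cantor_phi_nth) (simp add: cantor_phi_letter_def)
next
  case (Suc n)
  have "i < p * length ((cantor_phi p ^^ Suc n) [1 :: 'a])"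
    using Suc.prems assms(2) by (simp add: length_cantor_phi_funpow less_le_trans)
  then have "(cantor_phi p ^^ Suc (Suc n)) [1 :: 'a] ! i
      = (cantor_phi p ^^ Suc n) [1] ! (i div p) * cantor_phi_letter p 1 ! (i mod p)"
    by (simp add: cantor_phi_nth)
  also have "(cantor_phi p ^^ Suc n) [1 :: 'a] ! (i div p) = (cantor_phi p ^^ n) [1] ! (i div p)"
    using Suc.prems assms(2) by (intro Suc.IH) (simp add: less_mult_imp_div_less mult.commute)
  also have "\<dots> * cantor_phi_letter p 1 ! (i mod p) = (cantor_phi p ^^ Suc n) [1] ! i"
    using Suc.prems by (simp add: cantor_phi_nth length_cantor_phi_funpow)
  finally show ?case .
qed

lemma cantor_seq_eq:
  assumes "i < p ^ n" "p > 1"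
  shows "cantor_seq p i = ((cantor_phi p ^^ n) [1 :: 'a::field]) ! i"
proof -
  have *: "(cantor_phi p ^^ (n + k)) [1 :: 'a] ! i = (cantor_phi p ^^ n) [1] ! i"
    if "i < p ^ n" for n k
  proof (induction k)
    case (Suc k)
    have "i < p ^ (n + k)"
      using that assms(2) by (simp add: power_add less_le_trans)
    then show ?case
      using Suc cantor_phi_funpow_stable[of i p "n + k", where ?'a = 'a] assms(2) by simp
  qed simp
  have "i < p ^ Suc i"
    using power_gt_expt[of p "Suc i"] assms(2) by simp
  then show ?thesis
    using *[of n "Suc i"] *[of "Suc i" n] assms by (simp add: cantor_seq_def add.commute)
qed

lemma cantor_seq_0: "p > 1 \<Longrightarrow> cantor_seq p 0 = (1 :: 'a::field)"
  by (subst cantor_seq_eq[of _ _ 0]) auto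

text \<open>The limit word is fixed by the substitution, which peels off the last base
  \<open>p\<close> digit of the index.\<close>

lemma cantor_seq_rec:
  assumes "p > 1"
  shows "cantor_seq p i = (cantor_seq p (i div p) * cantor_phi_letter p 1 ! (i mod p) :: 'a::field)"
proof -
  have i: "i < p ^ Suc i"
    using power_gt_expt[of p "Suc i"] assms by simp
  then have "cantor_seq p i = (cantor_phi p ^^ Suc i) [1 :: 'a] ! i"
    using assms by (intro cantor_seq_eq)
  also have "\<dots> = (cantor_phi p ^^ i) [1] ! (i div p) * cantor_phi_letter p 1 ! (i mod p)"
    using i by (simp add: cantor_phi_nth length_cantor_phi_funpow)
  also have "(cantor_phi p ^^ i) [1 :: 'a] ! (i div p) = cantor_seq p (i div p)"
    using i assms
    by (intro cantor_seq_eq[symmetric]) (simp_all add: less_mult_imp_div_less mult.commute)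
  finally show ?thesis .
qed

text \<open>Translation by 1 permutes the field, so summing over all elements shows that
  \<open>p\<close> vanishes in it.\<close>

lemma CHAR_eq_CARD:
  assumes "prime p" "CARD('a::{field,finite}) = p"
  shows "CHAR('a) = p"
proof -
  have "(\<Sum>x\<in>UNIV. x + 1 :: 'a) = (\<Sum>x\<in>UNIV. x)"
    by (rule sum.reindex_bij_betw) (rule bij_betwI[of _ _ _ "\<lambda>x. x - 1"], auto)
  then have "(of_nat p :: 'a) = 0"
    using assms(2) by (simp add: sum.distrib)
  then have "CHAR('a) dvd p"
    by (simp add: of_nat_eq_0_iff_char_dvd)
  then show ?thesis
    using assms(1) by (metis CHAR_not_1' prime_nat_iff One_nat_def)
qed

section \<open>Functional equation and square of the generating series\<close>

definition cantor_fps :: "nat \<Rightarrow> 'a::field fps" where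
  "cantor_fps p = Abs_fps (cantor_seq p)"

text \<open>The polynomial factor has degree \<open>p - 1\<close>, so its shifted copies in the
  product do not overlap: \<open>n div p\<close> selects the coefficient of the first factor and
  \<open>n mod p\<close> that of the second.\<close>

lemma cantor_fps_functional_equation:
  assumes p: "p > 1" "odd p"
  shows "(cantor_fps p :: 'a::field fps)
    = (cantor_fps p oo fps_X ^ p) * (1 + fps_X ^ 2) ^ ((p - 1) div 2)"
proof (rule fps_ext)
  fix n
  define r where "r = (p - 1) div 2"
  define g where "g = ((1 + fps_X ^ 2) ^ r :: 'a fps)"
  have r: "p = Suc (2 * r)"
    using p by (auto simp: r_def elim!: oddE)
  have g_nth: "fps_nth g j = (if even j then of_nat (r choose (j div 2)) else 0)" for j
  proof -
    have "g = (\<Sum>k\<le>r. fps_const (of_nat (r choose k)) * fps_X ^ (2 * k))"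
      unfolding g_def by (subst add.commute) (simp add: binomial_ring fps_of_nat power_mult)
    then have "fps_nth g j = (\<Sum>k\<le>r. of_nat (r choose k) * (if j = 2 * k then 1 else 0))"
      by (simp add: fps_sum_nth)
    also have "\<dots> = (\<Sum>k\<le>r. if k = j div 2 then (if even j then of_nat (r choose k) else 0) else 0)"
      by (intro sum.cong) auto
    also have "\<dots> = (if even j then of_nat (r choose (j div 2)) else 0)"
      by (auto simp: sum.delta binomial_eq_0)
    finally show ?thesis .
  qed
  have g_letter: "fps_nth g j = cantor_phi_letter p 1 ! j" if "j < p" for j
    using that by (simp add: g_nth cantor_phi_letter_def r_def)
  have g_zero: "fps_nth g j = 0" if "j \<ge> p" for j
    using that r by (auto simp: g_nth binomial_eq_0 elim!: evenE)
  have "fps_nth ((cantor_fps p oo fps_X ^ p) * g) n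
      = (\<Sum>i=0..n. (if p dvd i then cantor_seq p (i div p) else 0) * fps_nth g (n - i))"
    by (simp add: fps_mult_nth fps_nth_compose_X_power cantor_fps_def cong: if_cong)
  also have "\<dots> = (\<Sum>i\<in>{n - n mod p}. (if p dvd i then cantor_seq p (i div p) else 0) * fps_nth g (n - i))"
  proof (intro sum.mono_neutral_right ballI)
    fix i assume i: "i \<in> {0..n} - {n - n mod p}"
    show "(if p dvd i then cantor_seq p (i div p) else 0) * fps_nth g (n - i) = 0"
    proof (cases "p dvd i")
      case True
      then obtain q where q: "i = p * q" ..
      have "n - i \<ge> p"
      proof (rule ccontr)
        assume "\<not> p \<le> n - i"
        then have "n div p = q"
          using i q by (intro div_nat_eqI) auto
        then have "n - n mod p = i"
          by (simp add: q minus_mod_eq_mult_div)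
        with i show False by simp
      qed
      then show ?thesis
        by (simp add: g_zero)
    qed simp
  qed auto
  also have "\<dots> = fps_nth (cantor_fps p) n"
  proof -
    have "n - (n - n mod p) = n mod p"
      by simp
    then show ?thesis
      using p cantor_seq_rec[of p n, where ?'a = 'a] by (simp add: cantor_fps_def g_letter minus_mod_eq_mult_div)
  qed
  finally show "fps_nth (cantor_fps p :: 'a fps) n
      = fps_nth ((cantor_fps p oo fps_X ^ p) * (1 + fps_X ^ 2) ^ ((p - 1) div 2)) n"
    unfolding g_def r_def by (rule sym)
qed

lemma cantor_fps_square:
  assumes p: "prime p" "odd p" "CHAR('a::field) = p"
  shows "(cantor_fps p :: 'a fps) ^ 2 * (1 + fps_X ^ 2) = 1"
proof -
  define c where "c = (cantor_fps p :: 'a fps)"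
  define Z where "Z = c ^ 2 * (1 + fps_X ^ 2)"
  have p1: "p > 1"
    using p prime_gt_1_nat by blast
  have X0: "fps_nth (fps_X ^ p :: 'a fps) 0 = 0"
    using p1 by simp
  have frob: "(1 + fps_X ^ 2 :: 'a fps) ^ p = 1 + fps_X ^ (2 * p)"
  proof -
    have "prime CHAR('a fps)" "p = CHAR('a fps)"
      using p by simp_all
    from freshmans_dream[OF this, of 1 "fps_X ^ 2"] show ?thesis
      by (simp only: power_one power_mult)
  qed
  \<comment> \<open>The exponents of \<open>1 + X^2\<close> add up to \<open>p\<close>, and
    Frobenius turns \<open>(1 + X^2)^p\<close> into \<open>1 + X^(2p)\<close>.\<close>
  have "Z = (c oo fps_X ^ p) ^ 2 * ((1 + fps_X ^ 2) ^ ((p - 1) div 2)) ^ 2 * (1 + fps_X ^ 2)"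
    unfolding Z_def
    by (subst c_def, subst cantor_fps_functional_equation[OF p1 p(2)])
      (simp only: c_def power_mult_distrib)
  also have "\<dots> = (c oo fps_X ^ p) ^ 2 * (1 + fps_X ^ 2) ^ Suc ((p - 1) div 2 * 2)"
    by (simp only: power_Suc2 power_mult mult.assoc)
  also have "Suc ((p - 1) div 2 * 2) = p"
    using p1 p(2) by (auto elim!: oddE)
  also have "(c oo fps_X ^ p) ^ 2 * (1 + fps_X ^ 2) ^ p = Z oo fps_X ^ p"
  proof -
    have "(1 + fps_X ^ 2 :: 'a fps) oo fps_X ^ p = 1 + (fps_X ^ p) ^ 2"
      using p1 by (simp add: fps_compose_add_distrib flip: fps_compose_power[OF X0])
    then have "Z oo fps_X ^ p = (c oo fps_X ^ p) ^ 2 * (1 + (fps_X ^ p) ^ 2)"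
      unfolding Z_def fps_compose_mult_distrib[OF X0] by (simp only: fps_compose_power[OF X0])
    then show ?thesis
      by (simp only: frob mult.commute[of 2 p] power_mult)
  qed
  finally have eq: "Z = Z oo fps_X ^ p" .
  have Z0: "fps_nth Z 0 = 1"
    using p1 by (simp add: Z_def c_def cantor_fps_def cantor_seq_0 power2_eq_square)
  \<comment> \<open>Comparing coefficients in \<open>Z(X) = Z(X^p)\<close> descends from
    \<open>n\<close> to \<open>n div p\<close>, so only the constant term survives.\<close>
  have "fps_nth Z n = (if n = 0 then 1 else 0)" for n
  proof (induction n rule: less_induct)
    case (less n)
    have "fps_nth Z n = (if p dvd n then fps_nth Z (n div p) else 0)"
      by (subst eq) (use p1 in \<open>simp add: fps_nth_compose_X_power\<close>)
    with less[of "n div p"] Z0 p1 show ?case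
      by (cases "n = 0") (auto dest!: dvd_div_eq_0_iff)
  qed
  then show ?thesis
    by (simp add: fps_eq_iff Z_def c_def)
qed

lemma Theta_square:
  assumes p: "prime p" "odd p" "CHAR('a::field) = p"
  shows "(Theta p :: 'a fls) ^ 2 * poly_to_tls [:1, 0, 1:] = 1"
proof -
  have "(Theta p :: 'a fls) ^ 2 * poly_to_tls [:1, 0, 1:]
     = fps_to_fls (cantor_fps p) ^ 2 * (fls_X ^ 2 * (1 + fls_X_inv * fls_X_inv))"
    by (simp add: Theta_def cantor_fps_def poly_to_tls_pCons power_mult_distrib algebra_simps)
  also have "fls_X ^ 2 * (1 + fls_X_inv * fls_X_inv) = (1 + fls_X ^ 2 :: 'a fls)"
  proof -
    have "fls_X * fls_X_inv = (1 :: 'a fls)"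
      by (simp add: fls_X_inv_times_conv_shift fls_X_conv_shift_1)
    then show ?thesis
      by (simp add: power2_eq_square algebra_simps)
  qed
  also have "\<dots> = fps_to_fls (1 + fps_X ^ 2)"
    by (simp add: fps_to_fls_power)
  also have "fps_to_fls (cantor_fps p) ^ 2 * \<dots> = fps_to_fls (cantor_fps p ^ 2 * (1 + fps_X ^ 2))"
    by (simp add: fls_times_fps_to_fls fps_to_fls_power)
  finally show ?thesis
    by (simp add: cantor_fps_square[OF p])
qed

lemma Theta_nth_1: "p > 1 \<Longrightarrow> fls_nth (Theta p) 1 = (1 :: 'a::field)"
  by (simp add: Theta_def fls_X_times_conv_shift cantor_seq_0)

lemma fls_subdegree_Theta: "p > 1 \<Longrightarrow> fls_subdegree (Theta p :: 'a::field fls) = 1"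
  by (rule fls_subdegree_eqI) (simp_all add: Theta_nth_1, simp add: Theta_def fls_X_times_conv_shift)

section \<open>Powers of the fundamental unit\<close>

definition pell_t :: "'a::field poly" where
  "pell_t = [:0, 1:]"

definition pell_D :: "'a::field poly" where
  "pell_D = pell_t * pell_t + 1"

lemma pell_D_eq: "pell_D = [:1, 0, 1:]"
  by (simp add: pell_D_def pell_t_def one_pCons)

lemma pell_t_nonzero [simp]: "pell_t \<noteq> 0"
  by (simp add: pell_t_def)

lemma degree_pell_t [simp]: "degree (pell_t ^ n) = n"
  by (simp add: pell_t_def degree_power_eq)

text \<open>With $w = \sqrt{t^2 + 1}$ these are the coordinates of $(t + w)^n = T_n + U_n w$.\<close>

fun pell_T :: "nat \<Rightarrow> 'a::field poly" and pell_U :: "nat \<Rightarrow> 'a poly" where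
  "pell_T 0 = 1"
| "pell_T (Suc n) = pell_t * pell_T n + pell_D * pell_U n"
| "pell_U 0 = 0"
| "pell_U (Suc n) = pell_T n + pell_t * pell_U n"

declare pell_T.simps(2) [simp del] pell_U.simps(2) [simp del]

lemma pell_add:
  "pell_T (m + n) = pell_T m * pell_T n + pell_D * (pell_U m * pell_U n :: 'a::field poly)
    \<and> pell_U (m + n) = pell_T m * pell_U n + pell_U m * (pell_T n :: 'a poly)"
  by (induction n) (simp_all add: pell_T.simps(2) pell_U.simps(2) algebra_simps)

lemmas pell_T_add = pell_add[THEN conjunct1]
lemmas pell_U_add = pell_add[THEN conjunct2]

text \<open>The unit \<open>t + w\<close> has norm \<open>t^2 - D = -1\<close>, and norms
  multiply.\<close>

lemma pell_norm: "pell_T n * pell_T n - pell_D * (pell_U n * pell_U n) = (- 1 :: 'a::field poly) ^ n"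
proof (induction n)
  case (Suc n)
  have "pell_T (Suc n) * pell_T (Suc n) - pell_D * (pell_U (Suc n) * pell_U (Suc n))
      = - (pell_T n * pell_T n - pell_D * (pell_U n * pell_U n) :: 'a poly)"
    by (simp add: pell_T.simps pell_U.simps) (simp add: pell_D_def algebra_simps)
  with Suc show ?case
    by simp
qed simp

text \<open>Dividing by \<open>u^n\<close> means multiplying by its conjugate, up to the norm
  \<open>(-1)^n\<close>; the sign stays on the left.\<close>

lemma pell_diff:
  fixes m n :: nat
  assumes "n \<le> m"
  shows "(- 1) ^ n * pell_T (m - n) = pell_T m * pell_T n - pell_D * (pell_U m * pell_U n :: 'a::field poly)"
    and "(- 1) ^ n * pell_U (m - n) = pell_U m * pell_T n - pell_T m * (pell_U n :: 'a poly)"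
proof -
  have m: "pell_T m = pell_T (m - n) * pell_T n + pell_D * (pell_U (m - n) * pell_U n :: 'a poly)"
    "pell_U m = pell_T (m - n) * pell_U n + pell_U (m - n) * (pell_T n :: 'a poly)"
    using pell_add[of "m - n" n, where ?'a = 'a] assms by simp_all
  show "(- 1) ^ n * pell_T (m - n) = pell_T m * pell_T n - pell_D * (pell_U m * pell_U n :: 'a poly)"
    unfolding pell_norm[symmetric] m by (simp only: algebra_simps)
  show "(- 1) ^ n * pell_U (m - n) = pell_U m * pell_T n - pell_T m * (pell_U n :: 'a poly)"
    unfolding pell_norm[symmetric] m by (simp only: algebra_simps)
qed

lemma coprime_bezout:
  fixes P Q :: "'a::field poly"
  assumes "A * P + B * Q = C" "C dvd 1"
  shows "coprime P Q"
proof (rule coprimeI)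
  fix c assume "c dvd P" "c dvd Q"
  then have "c dvd C"
    unfolding assms(1)[symmetric] by (intro dvd_add dvd_mult)
  with assms(2) show "c dvd 1"
    by (rule dvd_trans[rotated])
qed

text \<open>Writing \<open>Q = c + t R\<close> with \<open>c\<close> nonzero gives
  \<open>1 = (Q - t R) / c\<close>; inserting this into a relation for \<open>t^n\<close> yields one
  for \<open>t^(n+1)\<close>.\<close>

lemma bezout_pell_t_power:
  fixes Q :: "'a::field poly"
  assumes "n = 0 \<or> poly Q 0 \<noteq> 0"
  shows "\<exists>A B. A * pell_t ^ n + B * Q = 1"
  using assms
proof (induction n)
  case 0
  have "1 * pell_t ^ 0 + 0 * Q = 1"
    by simp
  then show ?case by blast
next
  case (Suc n)
  obtain c R where Q: "Q = pCons c R"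
    by (cases Q)
  obtain A B where AB: "A * pell_t ^ n + B * Q = 1"
    using Suc by auto
  have c: "c \<noteq> 0"
    using Suc.prems by (simp add: Q)
  define a where "a = [:inverse c:]"
  have "a * (Q - pell_t * R) = 1"
    using c by (simp add: a_def Q pell_t_def one_pCons)
  moreover have "(- a * R * A) * pell_t ^ Suc n + (a * A * pell_t ^ n + B) * Q
      = A * pell_t ^ n * (a * (Q - pell_t * R)) + B * Q"
    by (simp add: algebra_simps)
  ultimately have "(- a * R * A) * pell_t ^ Suc n + (a * A * pell_t ^ n + B) * Q = 1"
    using AB by simp
  then show ?case
    by blast
qed

lemma minus_one_power_unit: "(- 1) ^ n dvd (1 :: 'a::field poly)"
  by (rule dvdI[of _ _ "(- 1) ^ n"]) simp

text \<open>The hypothesis is what the Frobenius map provides for $q$ a power of $p$.\<close>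

lemma pell_dvd_multiples:
  assumes "pell_T q = (pell_t ^ q :: 'a::field poly)"
  shows "pell_t ^ q dvd (pell_U (2 * q * i) :: 'a poly)"
    and "pell_t ^ q dvd (pell_T (q + 2 * q * i) :: 'a poly)"
proof -
  have *: "pell_t ^ q dvd (pell_U (2 * q) :: 'a poly)"
    unfolding mult_2 pell_U_add assms by (intro dvd_add) simp_all
  show **: "pell_t ^ q dvd (pell_U (2 * q * i) :: 'a poly)" for i
  proof (induction i)
    case (Suc i)
    have "pell_U (2 * q * Suc i) = pell_T (2 * q) * pell_U (2 * q * i)
        + pell_U (2 * q) * (pell_T (2 * q * i) :: 'a poly)"
      by (simp only: mult_Suc_right pell_U_add)
    with Suc * show ?case
      by (simp only: dvd_add dvd_mult dvd_mult2)
  qed simp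
  show "pell_t ^ q dvd (pell_T (q + 2 * q * i) :: 'a poly)"
    unfolding pell_T_add assms by (intro dvd_add dvd_mult ** dvd_triv_left)
qed

lemma X_dvd_pell_U_even: "even n \<Longrightarrow> pell_t dvd (pell_U n :: 'a::field poly)"
  using pell_dvd_multiples(1)[of 1 "n div 2"] by (simp add: pell_T.simps(2))

text \<open>In the ring $R[\sqrt D]$ let $A$, $C$, $e$, $S$ be elements with $A$, $C$, $S$ of norm 1, and
  put $\Pi = 1 + h - hS$. The left side is the determinant of $A\Pi - C$ and $A\Pi e - C\bar e$,
  in which the mixed terms cancel, so that it equals $(N(\Pi) - 1)$ times the second coordinate
  of $e$.\<close>

lemma block_determinant:
  fixes h D aT aU cT cU sT sU eT eU :: "'r::comm_ring_1"
  assumes a: "aT * aT - D * (aU * aU) = 1" and c: "cT * cT - D * (cU * cU) = 1"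
    and s: "sT * sT - D * (sU * sU) = 1"
  defines "xT \<equiv> \<lambda>aT aU cT. (1 + h) * aT - h * (aT * sT + D * (aU * sU)) - cT"
    and "xU \<equiv> \<lambda>aT aU cU. (1 + h) * aU - h * (aT * sU + aU * sT) - cU"
  shows "xT aT aU cT * xU (aT * eT + D * (aU * eU)) (aT * eU + aU * eT) (cU * eT - cT * eU)
      - xT (aT * eT + D * (aU * eU)) (aT * eU + aU * eT) (cT * eT - D * (cU * eU)) * xU aT aU cU
    = 2 * h * (1 + h) * (1 - sT) * eU"
proof -
  \<comment> \<open>\<open>p1\<close>, \<open>p2\<close> are the coordinates of Pi, and
    \<open>b1\<close>, \<open>b2\<close> those of its product with \<open>A\<close>.\<close>
  define p1 p2 b1 b2 where "p1 = 1 + h - h * sT" and "p2 = - (h * sU)"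
    and "b1 = aT * p1 + D * (aU * p2)" and "b2 = aT * p2 + aU * p1"
  have xT: "xT aT aU cT = b1 - cT" "xU aT aU cU = b2 - cU"
    "xT (aT * eT + D * (aU * eU)) (aT * eU + aU * eT) (cT * eT - D * (cU * eU))
      = (b1 * eT + D * (b2 * eU)) - (cT * eT - D * (cU * eU))"
    "xU (aT * eT + D * (aU * eU)) (aT * eU + aU * eT) (cU * eT - cT * eU)
      = (b1 * eU + b2 * eT) - (cU * eT - cT * eU)"
    by (simp_all add: xT_def xU_def b1_def b2_def p1_def p2_def algebra_simps)
  have "p1 * p1 - D * (p2 * p2)
      = 1 + 2 * h * (1 + h) * (1 - sT) + h * h * (sT * sT - D * (sU * sU) - 1)"
    by (simp add: p1_def p2_def algebra_simps)
  then have p: "p1 * p1 - D * (p2 * p2) = 1 + 2 * h * (1 + h) * (1 - sT)"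
    by (simp add: s)
  have "b1 * b1 - D * (b2 * b2) = (aT * aT - D * (aU * aU)) * (p1 * p1 - D * (p2 * p2))"
    by (simp add: b1_def b2_def algebra_simps)
  then have b: "b1 * b1 - D * (b2 * b2) = 1 + 2 * h * (1 + h) * (1 - sT)"
    by (simp add: a p)
  have "(b1 - cT) * ((b1 * eU + b2 * eT) - (cU * eT - cT * eU))
      - ((b1 * eT + D * (b2 * eU)) - (cT * eT - D * (cU * eU))) * (b2 - cU)
    = (b1 * b1 - D * (b2 * b2) - (cT * cT - D * (cU * cU))) * eU"
    by (simp add: algebra_simps)
  then show ?thesis
    by (simp add: xT b c)
qed

text \<open>The coordinates of $(1 + h)u^a - hu^{a+2s} - u^c$ with $u = t + w$. For $a + c = 2sh$ its
  first coordinate vanishes to order $2s$ at $t = 0$ because $u^{2s} = 1 + 2t^s\cdots$.\<close>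

definition block_T :: "nat \<Rightarrow> nat \<Rightarrow> nat \<Rightarrow> nat \<Rightarrow> 'a::field poly" where
  "block_T s h a c = of_nat (1 + h) * pell_T a - of_nat h * pell_T (a + 2 * s) - pell_T c"

definition block_U :: "nat \<Rightarrow> nat \<Rightarrow> nat \<Rightarrow> nat \<Rightarrow> 'a::field poly" where
  "block_U s h a c = of_nat (1 + h) * pell_U a - of_nat h * pell_U (a + 2 * s) - pell_U c"

section \<open>Divisibility and coprimality of the block coordinates\<close>

context
  fixes s :: nat
  assumes s: "pell_T s = (pell_t ^ s :: 'a::field poly)" "odd s"
begin

text \<open>For odd \<open>s\<close> the norm of \<open>u^s\<close> is -1, which expresses
  \<open>D U_s^2\<close> through \<open>t^(2s)\<close>; then apply the doubling formulas.\<close>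

lemma pell_2s:
  "pell_T (2 * s) = (1 + 2 * pell_t ^ (2 * s) :: 'a poly)"
  "pell_t ^ s dvd (pell_U (2 * s) :: 'a poly)"
proof -
  have eq: "pell_D * (pell_U s * pell_U s) = (pell_t ^ s * pell_t ^ s + 1 :: 'a poly)"
    using pell_norm[of s, where ?'a = 'a] s by (simp add: algebra_simps)
  show "pell_T (2 * s) = (1 + 2 * pell_t ^ (2 * s) :: 'a poly)"
    unfolding mult_2 pell_T_add eq s(1) power_add by simp
  show "pell_t ^ s dvd (pell_U (2 * s) :: 'a poly)"
    unfolding mult_2 pell_U_add s(1) by (intro dvd_add) simp_all
qed

text \<open>Modulo \<open>t^(2s)\<close> the element \<open>u^(2s)\<close> is \<open>1 + V w\<close>
  with \<open>V^2 = 0\<close>, so its \<open>h\<close>-th power is \<open>1 + h V w\<close>.\<close>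

lemma pell_2sh:
  "pell_t ^ (2 * s) dvd (pell_T (2 * s * h) - 1 :: 'a poly)
    \<and> pell_t ^ (2 * s) dvd (pell_U (2 * s * h) - of_nat h * pell_U (2 * s) :: 'a poly)"
proof (induction h)
  case (Suc h)
  define z where "z = (pell_t ^ (2 * s) :: 'a poly)"
  define T U V where "T = (pell_T (2 * s * h) :: 'a poly)" and "U = (pell_U (2 * s * h) :: 'a poly)"
    and "V = (pell_U (2 * s) :: 'a poly)"
  have S: "pell_T (2 * s) = 1 + 2 * z"
    by (simp only: pell_2s(1) z_def)
  have V: "z dvd V * V"
    using mult_dvd_mono[OF pell_2s(2) pell_2s(2)] by (simp add: z_def V_def mult_2 power_add)
  have IH: "z dvd T - 1" "z dvd U - of_nat h * V"
    using Suc by (simp_all add: z_def T_def U_def V_def)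
  have "pell_T (2 * s * Suc h) - 1 = (T - 1) + z * (2 * T) + pell_D * V * (U - of_nat h * V)
      + pell_D * of_nat h * (V * V)"
    by (simp only: mult_Suc_right pell_T_add S flip: T_def U_def V_def) (simp add: algebra_simps)
  moreover have "pell_U (2 * s * Suc h) - of_nat (Suc h) * V
      = (U - of_nat h * V) + z * (2 * U) + (T - 1) * V"
    by (simp only: mult_Suc_right pell_U_add S flip: T_def U_def V_def) (simp add: algebra_simps)
  ultimately show ?case
    using IH V unfolding z_def[symmetric] V_def[symmetric]
    by (simp only: dvd_add dvd_mult dvd_mult2 dvd_triv_left simp_thms)
qed simp

text \<open>As \<open>a\<close> is even, \<open>u^c\<close> is \<open>u^(2sh)\<close> times the
  conjugate of \<open>u^a\<close>. Inserting \<open>u^(2sh) = 1 + h V w\<close> modulo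
  \<open>t^(2s)\<close> cancels the first coordinate; the second involves only even powers of
  \<open>u\<close>.\<close>

lemma pell_t_dvd_block:
  assumes ac: "a + c = 2 * s * h" and a: "even a"
  shows "pell_t ^ (2 * s) dvd (block_T s h a c :: 'a poly)"
    and "pell_t dvd (block_U s h a c :: 'a poly)"
proof -
  define z where "z = (pell_t ^ (2 * s) :: 'a poly)"
  define T U V where "T = (pell_T (2 * s * h) :: 'a poly)" and "U = (pell_U (2 * s * h) :: 'a poly)"
    and "V = (pell_U (2 * s) :: 'a poly)"
  have c: "pell_T c = T * pell_T a - pell_D * (U * pell_U a)"
    using pell_diff(1)[of a "2 * s * h", where ?'a = 'a] a
    by (simp add: T_def U_def flip: ac)
  have "block_T s h a c = - (T - 1) * pell_T a + pell_D * pell_U a * (U - of_nat h * V)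
      - z * (2 * of_nat h * pell_T a)"
    by (simp only: block_T_def c pell_T_add pell_2s(1) flip: z_def V_def) (simp add: algebra_simps)
  then show "pell_t ^ (2 * s) dvd (block_T s h a c :: 'a poly)"
    using pell_2sh[of h] unfolding z_def[symmetric] T_def[symmetric] U_def[symmetric] V_def[symmetric]
    by (simp only: dvd_add dvd_diff dvd_mult dvd_mult2 dvd_triv_left dvd_minus_iff)
  have "even c"
    using ac a by (metis even_add even_mult_iff even_numeral)
  then show "pell_t dvd (block_U s h a c :: 'a poly)"
    unfolding block_U_def using a by (intro dvd_diff dvd_mult X_dvd_pell_U_even) auto
qed

text \<open>Taking \<open>e = u^2\<close> in \<open>block_determinant\<close> compares the block
  with its neighbour \<open>(a + 2, c - 2)\<close>; the determinant is
  \<open>-8 h (1 + h) t^(2s+1)\<close>. Removing the factors \<open>t^(2s)\<close> and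
  \<open>t\<close> leaves a nonzero constant, hence a Bezout relation for \<open>P\<close> and
  \<open>Q\<close>.\<close>

lemma block_coprime:
  assumes ac: "a + c = 2 * s * h" "even a" "c \<ge> 2"
    and h: "of_nat h \<noteq> (0 :: 'a)" "of_nat (1 + h) \<noteq> (0 :: 'a)" "(2 :: 'a) \<noteq> 0"
    and Q: "block_T s h a c = pell_t ^ (2 * s) * Q" and P: "block_U s h a c = pell_t * P"
  shows "coprime P (Q :: 'a poly)"
proof -
  have ac': "(a + 2) + (c - 2) = 2 * s * h" "even (a + 2)" "even c"
    using ac by (simp, simp, metis even_add even_mult_iff even_numeral)
  obtain Q' P' where Q': "block_T s h (a + 2) (c - 2) = pell_t ^ (2 * s) * (Q' :: 'a poly)"
    and P': "block_U s h (a + 2) (c - 2) = pell_t * (P' :: 'a poly)"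
    using pell_t_dvd_block[OF ac'(1,2)] by (meson dvdE)
  have norm: "pell_T n * pell_T n - pell_D * (pell_U n * pell_U n) = (1 :: 'a poly)" if "even n" for n
    using pell_norm[of n, where ?'a = 'a] that by simp
  have c2: "pell_T (c - 2) = pell_T c * pell_T 2 - pell_D * (pell_U c * pell_U 2 :: 'a poly)"
    "pell_U (c - 2) = pell_U c * pell_T 2 - pell_T c * (pell_U 2 :: 'a poly)"
    using pell_diff[of 2 c, where ?'a = 'a] ac by simp_all
  have aa: "pell_T (a + 2) = pell_T a * pell_T 2 + pell_D * (pell_U a * pell_U 2 :: 'a poly)"
    "pell_U (a + 2) = pell_T a * pell_U 2 + pell_U a * (pell_T 2 :: 'a poly)"
    by (simp_all only: pell_T_add pell_U_add)
  have as: "pell_T (n + 2 * s) = pell_T n * pell_T (2 * s) + pell_D * (pell_U n * pell_U (2 * s) :: 'a poly)"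
    "pell_U (n + 2 * s) = pell_T n * pell_U (2 * s) + pell_U n * (pell_T (2 * s) :: 'a poly)" for n
    by (simp_all only: pell_T_add pell_U_add)
  have U2: "pell_U 2 = (2 * pell_t :: 'a poly)"
    by (simp add: numeral_2_eq_2 pell_T.simps(2) pell_U.simps(2))
  define H where "H = (of_nat h :: 'a poly)"
  have "block_T s h a c * block_U s h (a + 2) (c - 2) - block_T s h (a + 2) (c - 2) * block_U s h a c
      = 2 * H * (1 + H) * (1 - pell_T (2 * s)) * (pell_U 2 :: 'a poly)"
    using block_determinant[OF norm[OF ac(2)] norm[OF ac'(3)] norm[of "2 * s"],
        where h = H and eT = "pell_T 2" and eU = "pell_U 2"]
    by (simp only: block_T_def block_U_def as aa c2 of_nat_add of_nat_1 H_def even_mult_iff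
        even_numeral simp_thms)
  also have "\<dots> = (pell_t ^ (2 * s) * pell_t) * (- 8 * H * (1 + H))"
    by (simp only: pell_2s(1) U2) (simp add: algebra_simps)
  finally have "(pell_t ^ (2 * s) * pell_t) * (Q * P' - Q' * P)
      = (pell_t ^ (2 * s) * pell_t) * (- 8 * H * (1 + H))"
    unfolding Q P Q' P' by (simp add: algebra_simps)
  then have "Q * P' - Q' * P = - 8 * H * (1 + H)"
    by (subst (asm) mult_left_cancel) auto
  then have eq: "(- Q') * P + P' * Q = - 8 * H * (1 + H)"
    by (simp only: mult.commute[of P'] minus_mult_left[symmetric] add.commute[of "- _"]
        diff_conv_add_uminus)
  have const: "[:k:] dvd 1" if "k \<noteq> 0" for k :: 'a
    using that by (simp add: is_unit_iff_degree)
  have H: "H = [:of_nat h:]" "1 + H = [:of_nat (1 + h):]"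
    unfolding H_def of_nat_poly[symmetric] by simp_all
  have "(8 :: 'a) = 2 * 2 * 2"
    by simp
  then have "(8 :: 'a) \<noteq> 0"
    using h(3) by (metis mult_eq_0_iff)
  then have "(8 :: 'a poly) dvd 1"
    unfolding numeral_poly by (rule const)
  moreover have "H dvd 1"
    unfolding H(1) by (rule const) (rule h(1))
  moreover have "1 + H dvd 1"
    unfolding H(2) by (rule const) (rule h(2))
  ultimately have "- 8 * H * (1 + H) dvd 1"
    by (simp only: is_unit_mult_iff minus_dvd_iff simp_thms)
  with eq show ?thesis
    by (rule coprime_bezout)
qed

end

section \<open>The unit and its conjugate as Laurent series in \<open>1/t\<close>\<close>

locale sqrt_pell =
  fixes w :: "'a::{field,finite} fls"
  assumes w_square: "w ^ 2 = poly_to_tls pell_D"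
    and w_subdegree: "fls_subdegree w = - 1"
    and w_leading: "fls_nth w (- 1) = 1"
    and two: "(2 :: 'a) \<noteq> 0"
begin

definition \<omega> :: "'a fls" where
  "\<omega> = fls_X_inv - w"

definition \<epsilon> :: "'a fls" where
  "\<epsilon> = fls_X_inv + w"

abbreviation \<alpha> :: "nat \<Rightarrow> 'a fls" where
  "\<alpha> k \<equiv> inverse w * fls_X_inv ^ k"

text \<open>The partial sums are the degrees of convergent denominators of \<open>t^k / w\<close>.
  The index \<open>n\<close> is hidden because only positions measured in degrees can be
  computed.\<close>

definition hits :: "nat \<Rightarrow> nat \<Rightarrow> nat \<Rightarrow> bool" where
  "hits k \<mu> d \<longleftrightarrow> (\<exists>n. (\<Sum>i=1..n. degree (cf_pq (\<alpha> k) i)) = \<mu> \<and> degree (cf_pq (\<alpha> k) (Suc n)) = d)"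

lemma w_nonzero: "w \<noteq> 0"
  using w_subdegree by auto

lemma two_fls: "(2 :: 'a fls) \<noteq> 0" "fls_subdegree (2 * f) = fls_subdegree (f :: 'a fls)"
proof -
  have eq: "(2 :: 'a fls) = fls_const 2"
    by simp
  show *: "(2 :: 'a fls) \<noteq> 0"
    unfolding eq using two by (simp only: fls_const_eq_0_iff not_False_eq_True)
  show "fls_subdegree (2 * f) = fls_subdegree f"
    using * by (cases "f = 0") auto
qed

lemma X_inv_eq: "fls_X_inv = poly_to_tls (pell_t :: 'a poly)"
  by (simp add: pell_t_def poly_to_tls_pCons)

lemma unit_power:
  "\<epsilon> ^ n = poly_to_tls (pell_T n) + poly_to_tls (pell_U n) * w"
  "\<omega> ^ n = poly_to_tls (pell_T n) - poly_to_tls (pell_U n) * w"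
proof -
  have ww: "w * w = poly_to_tls pell_D"
    using w_square by (simp add: power2_eq_square)
  show "\<epsilon> ^ n = poly_to_tls (pell_T n) + poly_to_tls (pell_U n) * w"
  proof (induction n)
    case (Suc n)
    show ?case
      by (simp only: power_Suc Suc.IH) (simp add: \<epsilon>_def X_inv_eq pell_T.simps(2)
          pell_U.simps(2) poly_to_tls_add poly_to_tls_mult ww[symmetric] algebra_simps)
  qed simp
  show "\<omega> ^ n = poly_to_tls (pell_T n) - poly_to_tls (pell_U n) * w"
  proof (induction n)
    case (Suc n)
    show ?case
      by (simp only: power_Suc Suc.IH) (simp add: \<omega>_def X_inv_eq pell_T.simps(2)
          pell_U.simps(2) poly_to_tls_add poly_to_tls_mult ww[symmetric] algebra_simps)
  qed simp
qed

text \<open>By \<open>w_leading\<close> the leading terms of \<open>t\<close> and \<open>w\<close>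
  add up to coefficient 2, so \<epsilon> is the large one of the two conjugates.\<close>

lemma \<epsilon>_subdegree: "\<epsilon> \<noteq> 0" "fls_subdegree \<epsilon> = - 1"
proof -
  have *: "fls_nth \<epsilon> (- 1) \<noteq> 0"
    using two by (simp add: \<epsilon>_def w_leading)
  then show "\<epsilon> \<noteq> 0"
    by auto
  show "fls_subdegree \<epsilon> = - 1"
    by (rule fls_subdegree_eqI[OF *]) (simp add: \<epsilon>_def w_subdegree)
qed

lemma \<omega>_subdegree: "\<omega> \<noteq> 0" "fls_subdegree \<omega> = 1"
proof -
  have "\<epsilon> * \<omega> = fls_X_inv * fls_X_inv - w ^ 2"
    by (simp add: \<epsilon>_def \<omega>_def power2_eq_square algebra_simps)
  also have "\<dots> = - 1"
    by (simp add: w_square pell_D_eq poly_to_tls_pCons)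
  finally have *: "\<epsilon> * \<omega> = - 1" .
  then show **: "\<omega> \<noteq> 0"
    by auto
  have "fls_subdegree \<epsilon> + fls_subdegree \<omega> = 0"
    using * ** \<epsilon>_subdegree by (metis fls_subdegree_mult fls_uminus_subdegree fls_one_subdegree)
  then show "fls_subdegree \<omega> = 1"
    by (simp add: \<epsilon>_subdegree)
qed

lemma subdegree_unit_power:
  "fls_subdegree (\<omega> ^ n) = int n" "fls_subdegree (\<epsilon> ^ n) = - int n"
  using \<omega>_subdegree \<epsilon>_subdegree by (simp_all add: fls_subdegree_pow)

text \<open>Up to a factor 2, \<open>T_n\<close> is the sum and \<open>U_n w\<close> the difference
  of \<open>\<epsilon> ^ n\<close> and \<open>\<omega> ^ n\<close>, of which the first
  dominates.\<close>

lemma degree_pell: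
  shows "degree (pell_T n :: 'a poly) = n" and "n > 0 \<Longrightarrow> degree (pell_U n :: 'a poly) = n - 1"
    and "n > 0 \<Longrightarrow> pell_U n \<noteq> (0 :: 'a poly)"
proof -
  have less: "fls_subdegree (\<epsilon> ^ n) < fls_subdegree (\<omega> ^ n)" if "n > 0"
    using that by (simp only: subdegree_unit_power)
  have nz: "\<epsilon> ^ n \<noteq> 0"
    using \<epsilon>_subdegree by simp
  show "degree (pell_T n :: 'a poly) = n"
  proof (cases "n > 0")
    case True
    have "2 * poly_to_tls (pell_T n) = \<epsilon> ^ n + \<omega> ^ n"
      by (simp add: unit_power)
    then have "fls_subdegree (poly_to_tls (pell_T n :: 'a poly)) = - int n"
      using fls_subdegree_add_eq1[OF nz less[OF True]]
      by (metis two_fls(2) subdegree_unit_power(2))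
    then show ?thesis
      by (simp add: fls_subdegree_poly_to_tls)
  qed simp
  assume n: "n > 0"
  have eq: "2 * (poly_to_tls (pell_U n) * w) = \<epsilon> ^ n - \<omega> ^ n"
    by (simp add: unit_power)
  have "fls_subdegree (poly_to_tls (pell_U n) * w) = - int n"
    using fls_subdegree_diff_eq1[OF nz less[OF n]] eq
    by (metis two_fls(2) subdegree_unit_power(2))
  moreover from this show "pell_U n \<noteq> (0 :: 'a poly)"
    using n by auto
  ultimately have "- int (degree (pell_U n :: 'a poly)) - 1 = - int n"
    using w_nonzero by (simp add: fls_subdegree_poly_to_tls w_subdegree)
  then show "degree (pell_U n :: 'a poly) = n - 1"
    by simp
qed

text \<open>By Frobenius the sum of \<open>u^q\<close> and its conjugate is \<open>(2t)^q\<close>,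
  and \<open>2^q = 2\<close>.\<close>

lemma pell_T_prime_power:
  assumes "prime CHAR('a)" "q = CHAR('a) ^ j"
  shows "pell_T q = (pell_t ^ q :: 'a poly)"
proof -
  have q: "q = CHAR('a fls) ^ j" "prime CHAR('a fls)"
    using assms by simp_all
  have "2 * poly_to_tls (pell_T q) = \<epsilon> ^ q + \<omega> ^ q"
    by (simp add: unit_power)
  also have "\<dots> = (\<epsilon> + \<omega>) ^ q"
    using freshmans_dream'[OF q(2,1)] by simp
  also have "\<dots> = 2 ^ q * fls_X_inv ^ q"
  proof -
    have "\<epsilon> + \<omega> = 2 * fls_X_inv"
      by (simp add: \<epsilon>_def \<omega>_def)
    then show ?thesis
      by (simp only: power_mult_distrib)
  qed
  also have "(2 :: 'a fls) ^ q = 2"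
    using freshmans_dream'[OF q(2,1), of 1 1] by (simp only: one_add_one power_one)
  finally have "poly_to_tls (pell_T q) = poly_to_tls ((pell_t :: 'a poly) ^ q)"
    using two_fls(1) by (simp add: X_inv_eq poly_to_tls_power)
  then show ?thesis
    by (simp only: poly_to_tls_eq_iff)
qed

text \<open>With \<open>E = t^k w\<close> the series is \<open>(0 + E) / D\<close>; positivity of
  \<open>k\<close> makes the degree 2 of \<open>D\<close> at most \<open>k + 1\<close>.\<close>

lemma cf_eventually_periodic_alpha: "k > 0 \<Longrightarrow> cf_eventually_periodic (\<alpha> k)"
proof (rule cf_eventually_periodic_sqrt[OF two])
  let ?E = "fls_X_inv ^ k * w" and ?\<Delta> = "pell_t ^ (2 * k) * pell_D :: 'a poly"
  show "?E ^ 2 = poly_to_tls ?\<Delta>"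
    by (simp only: poly_to_tls_mult poly_to_tls_power X_inv_eq power_mult_distrib w_square
        power_mult[symmetric] mult.commute[of k])
  show "fls_subdegree ?E = - int (Suc k)"
    using w_nonzero by (simp add: w_subdegree)
  have "inverse w * poly_to_tls pell_D = w"
    using w_nonzero by (simp add: w_square[symmetric] power2_eq_square)
  then show "\<alpha> k * poly_to_tls pell_D = poly_to_tls 0 + ?E"
    by (simp add: mult.assoc mult.left_commute)
  show "pell_D dvd ?\<Delta> - 0 ^ 2"
    by simp
qed (auto simp: pell_D_eq)

section \<open>Explicit convergents of \<open>t^k / w\<close>\<close>

lemma hitsI:
  assumes "coprime P Q" "Q \<noteq> 0"
    and "f = fls_X_inv ^ k * poly_to_tls Q - poly_to_tls P * w" "f \<noteq> 0"
    and "fls_subdegree f + 1 = int (degree Q) + int d" "d > 0"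
  shows "hits k (degree Q) d"
proof -
  \<comment> \<open>Dividing by \<open>w\<close> raises the subdegree by one, which accounts for the
    \<open>+ 1\<close> in the hypothesis.\<close>
  have eq: "poly_to_tls Q * \<alpha> k - poly_to_tls P = inverse w * f"
    using w_nonzero by (simp add: assms(3) field_simps)
  show ?thesis
    unfolding hits_def
  proof (rule best_approximation[OF assms(1,2) _ assms(6)])
    show "fls_subdegree (poly_to_tls Q * \<alpha> k - poly_to_tls P) = int (degree Q) + int d"
      unfolding eq using assms(4,5) w_nonzero by (simp add: w_subdegree)
    show "poly_to_tls Q * \<alpha> k \<noteq> poly_to_tls P"
      using eq assms(4) w_nonzero by auto
  qed
qed

text \<open>The error is \<open>t^r \<omega>^m\<close>, of subdegree \<open>m - r\<close>. The norm
  equation makes \<open>Q\<close> coprime to \<open>U_m\<close>, and the condition on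
  \<open>Q\<close> at 0 makes it coprime to \<open>t^r\<close>.\<close>

lemma hits_T:
  fixes Q :: "'a poly"
  assumes T: "pell_T m = pell_t ^ s * Q" and Q: "r = 0 \<or> poly Q 0 \<noteq> 0" and r: "r \<le> s"
  shows "hits (s + r) (m - s) (s - r + 1)"
proof -
  have Q0: "Q \<noteq> 0" and m: "degree Q = m - s" "m \<ge> s"
  proof -
    have "pell_T m \<noteq> (0 :: 'a poly)"
      using degree_pell(1)[of m] by (cases "m = 0") auto
    then show "Q \<noteq> 0"
      using T by auto
    then have "m = s + degree Q"
      using degree_pell(1)[of m] T by (simp add: degree_mult_eq)
    then show "degree Q = m - s" "m \<ge> s"
      by simp_all
  qed
  have "(pell_t ^ s * pell_t ^ s * Q) * Q + (- (pell_D * pell_U m)) * pell_U m = (- 1) ^ m"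
    unfolding pell_norm[of m, symmetric] T by (simp add: algebra_simps)
  then have UQ: "(- (pell_D * pell_U m)) * pell_U m + (pell_t ^ s * pell_t ^ s * Q) * Q = (- 1) ^ m"
    by (simp add: add.commute)
  obtain A B where AB: "A * pell_t ^ r + B * Q = 1"
    using bezout_pell_t_power[OF Q] by blast
  have "((- (pell_D * pell_U m)) * A) * (pell_t ^ r * pell_U m)
      + ((- (pell_D * pell_U m)) * pell_U m * B + pell_t ^ s * pell_t ^ s * Q) * Q
      = ((- (pell_D * pell_U m)) * pell_U m) * (A * pell_t ^ r + B * Q)
        + (pell_t ^ s * pell_t ^ s * Q) * Q"
    by (simp only: algebra_simps)
  also have "\<dots> = (- 1) ^ m"
    by (simp only: AB UQ mult_1_right)
  finally have "coprime (pell_t ^ r * pell_U m) Q"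
    by (rule coprime_bezout) (rule minus_one_power_unit)
  moreover have "fls_X_inv ^ (s + r) * poly_to_tls Q - poly_to_tls (pell_t ^ r * pell_U m) * w
      = fls_X_inv ^ r * \<omega> ^ m"
    unfolding unit_power T
    by (simp only: poly_to_tls_mult poly_to_tls_power X_inv_eq power_add algebra_simps)
  ultimately have "hits (s + r) (degree Q) (s - r + 1)"
    using Q0 \<omega>_subdegree m r
    by (intro hitsI[where P = "pell_t ^ r * pell_U m" and f = "fls_X_inv ^ r * \<omega> ^ m"])
      (auto simp: subdegree_unit_power of_nat_diff)
  then show ?thesis
    by (simp add: m)
qed

text \<open>Multiplication by \<open>w\<close> exchanges the roles of the coordinates: the error is
  \<open>- w * \<omega> ^ m\<close>, with \<open>t^k Q = D U_m\<close>.\<close>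

lemma hits_U:
  assumes U: "pell_t ^ k dvd (pell_U m :: 'a poly)" and m: "m > 0" and k: "k \<ge> 2"
  shows "hits k (m + 1 - k) (k - 1)"
proof -
  obtain R where R: "pell_U m = (pell_t :: 'a poly) ^ k * R"
    using U by blast
  define Q where "Q = pell_D * R"
  have R0: "R \<noteq> 0"
    using degree_pell(3)[OF m] R by auto
  have "m - 1 = k + degree R"
    using degree_pell(2)[OF m] R R0 by (simp add: degree_mult_eq)
  moreover have "degree Q = 2 + degree R"
    using R0 unfolding Q_def by (subst degree_mult_eq) (auto simp: pell_D_eq)
  ultimately have degQ: "degree Q = m + 1 - k" "m + 1 \<ge> k"
    using m by auto
  have "pell_T m * pell_T m + (- (pell_t ^ k * pell_t ^ k * R)) * Q = (- 1) ^ m"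
    unfolding pell_norm[of m, symmetric] R Q_def by (simp add: algebra_simps)
  then have cop: "coprime (pell_T m) Q"
    by (rule coprime_bezout) (rule minus_one_power_unit)
  have "fls_X_inv ^ k * poly_to_tls Q = poly_to_tls (pell_U m) * w ^ 2"
    unfolding R Q_def w_square
    by (simp only: poly_to_tls_mult poly_to_tls_power X_inv_eq ac_simps)
  then have "fls_X_inv ^ k * poly_to_tls Q - poly_to_tls (pell_T m) * w = - w * \<omega> ^ m"
    unfolding unit_power by (simp add: power2_eq_square algebra_simps)
  moreover have "Q \<noteq> 0"
    using R0 unfolding Q_def mult_eq_0_iff by (simp add: pell_D_eq)
  moreover have "fls_subdegree (- w * \<omega> ^ m) = int m - 1" "- w * \<omega> ^ m \<noteq> 0"
    using w_nonzero \<omega>_subdegree by (simp_all add: subdegree_unit_power w_subdegree)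
  ultimately have "hits k (degree Q) (k - 1)"
    using cop degQ k by (intro hitsI[where P = "pell_T m" and f = "- w * \<omega> ^ m"]) auto
  then show ?thesis
    by (simp add: degQ)
qed

text \<open>The bounds on \<open>a\<close> put \<open>c = 2sh - a\<close> strictly between
  \<open>a\<close> and \<open>a + 2s\<close>. So the term with \<open>a + 2s\<close>, of coefficient
  \<open>-h\<close>, governs the degree, and the term with \<open>a\<close>, of coefficient
  \<open>1 + h\<close>, governs the error.\<close>

lemma hits_block:
  assumes s: "pell_T s = (pell_t ^ s :: 'a poly)" "odd s"
    and a: "even a" "s * (h - 1) < a" "a < s * h"
    and h: "of_nat h \<noteq> (0 :: 'a)" "of_nat (1 + h) \<noteq> (0 :: 'a)"
  shows "hits (2 * s - 1) a 2"
proof -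
  define c where "c = 2 * s * h - a"
  have h0: "h > 0" "s > 0"
    using a by (cases h; simp)+
  have ac: "a + c = 2 * s * h" "a < c" "c < a + 2 * s"
  proof -
    have "s * h = s * (h - 1) + s"
      using h0 by (cases h) auto
    then show "a + c = 2 * s * h" "a < c" "c < a + 2 * s"
      using a by (simp_all add: c_def)
  qed
  have c2: "c \<ge> 2"
    using a ac(2) by (auto elim!: evenE)
  obtain Q where Q: "block_T s h a c = pell_t ^ (2 * s) * (Q :: 'a poly)"
    using pell_t_dvd_block(1)[OF s ac(1) a(1)] by (elim dvdE)
  obtain P where P: "block_U s h a c = pell_t * (P :: 'a poly)"
    using pell_t_dvd_block(2)[OF s ac(1) a(1)] by (elim dvdE)
  have cop: "coprime P Q"
    by (rule block_coprime[OF s ac(1) a(1) c2 h two Q P])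
  have const: "of_nat n = [:of_nat n :: 'a:]" for n
    by (simp add: of_nat_poly)
  have "degree (of_nat (1 + h) * pell_T a - pell_T c :: 'a poly) < a + 2 * s"
    by (rule degree_diff_less) (use ac(2,3) in \<open>simp_all only: const mult_pCons_left
      mult_zero_left pCons_0_0 add_0_right degree_smult_eq degree_pell\<close>, auto)
  moreover have "degree (of_nat h * pell_T (a + 2 * s) :: 'a poly) = a + 2 * s"
    using h(1) unfolding const by (simp add: degree_pell)
  moreover have "block_T s h a c
      = (of_nat (1 + h) * pell_T a - pell_T c) - of_nat h * (pell_T (a + 2 * s) :: 'a poly)"
    by (simp add: block_T_def)
  ultimately have deg: "degree (block_T s h a c :: 'a poly) = a + 2 * s"
    by (metis degree_add_eq_right degree_minus uminus_add_conv_diff add.commute)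
  then have Q0: "Q \<noteq> 0"
    using Q h0 by auto
  then have degQ: "degree Q = a"
    using deg Q by (simp add: degree_mult_eq)
  define f where "f = fls_X_inv ^ (2 * s - 1) * poly_to_tls Q - poly_to_tls P * w"
  have "fls_X_inv * f = poly_to_tls (block_T s h a c) - poly_to_tls (block_U s h a c) * w"
  proof -
    have "fls_X_inv * fls_X_inv ^ (2 * s - 1) = (fls_X_inv :: 'a fls) ^ (2 * s)"
      using h0 by (simp flip: power_Suc)
    then show ?thesis
      by (simp add: f_def Q P poly_to_tls_mult poly_to_tls_power X_inv_eq algebra_simps)
  qed
  also have "\<dots> = fls_const (of_nat (1 + h)) * \<omega> ^ a
      - (fls_const (of_nat h) * \<omega> ^ (a + 2 * s) + \<omega> ^ c)"
  proof -
    have lin: "poly_to_tls (of_nat n * q) = fls_const (of_nat n) * poly_to_tls q" for n and q :: "'a poly"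
      by (simp add: const poly_to_tls_smult)
    show ?thesis
      unfolding unit_power block_T_def block_U_def poly_to_tls_diff lin
      by (simp only: algebra_simps)
  qed
  finally have f: "fls_X_inv * f = fls_const (of_nat (1 + h)) * \<omega> ^ a
      - (fls_const (of_nat h) * \<omega> ^ (a + 2 * s) + \<omega> ^ c)" .
  have nth: "fls_nth (\<omega> ^ n) (int i) = 0" if "i < n" for n i
    using that by (intro fls_eq0_below_subdegree) (simp add: subdegree_unit_power)
  have nth_a: "fls_nth (\<omega> ^ a) (int a) \<noteq> 0"
    using \<omega>_subdegree by (metis nth_fls_subdegree_nonzero power_not_zero subdegree_unit_power(1))
  have "fls_subdegree (fls_X_inv * f) = int a"
  proof (rule fls_subdegree_eqI)
    show "fls_nth (fls_X_inv * f) (int a) \<noteq> 0"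
      unfolding f using nth[of a "a + 2 * s"] nth[of a c] nth_a ac h(2) h0 by simp
    show "fls_nth (fls_X_inv * f) i = 0" if "i < int a" for i
      unfolding f using that ac by (simp add: subdegree_unit_power)
  qed
  moreover from this have f0: "f \<noteq> 0"
    using a(2) by auto
  ultimately have "fls_subdegree f + 1 = int (degree Q) + int 2"
    by (simp add: degQ)
  then have "hits (2 * s - 1) (degree Q) 2"
    by (intro hitsI[OF cop Q0 f_def f0]) auto
  then show ?thesis
    by (simp add: degQ)
qed

end

section \<open>The escape ratio\<close>

context sqrt_pell
begin

lemma alpha_altdef: "inverse w * poly_to_tls ([:0, 1:] ^ k) = \<alpha> k"
  by (simp add: poly_to_tls_power X_inv_eq pell_t_def)

text \<open>Each degree splits as \<open>(d - n) + min d n\<close>: applying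
  \<open>periodic_sum_ge\<close> to the first summand bounds the escaping mass from below, and to
  the second from above.\<close>

lemma escape_ratio_bounds:
  assumes k: "k > 0" and A: "A \<subseteq> {..<W}" "A \<noteq> {}"
    and hit: "\<And>\<mu> i. \<mu> \<in> A \<Longrightarrow> hits k (\<mu> + Suc i * W) (D \<mu>)"
    and D: "\<And>\<mu>. \<mu> \<in> A \<Longrightarrow> D \<mu> > 0"
  shows "escape_ratio (inverse w) [:0, 1:] k n \<ge> real (\<Sum>\<mu>\<in>A. D \<mu> - n) / real W"
    and "escape_ratio (inverse w) [:0, 1:] k n \<le> 1 - real (\<Sum>\<mu>\<in>A. min (D \<mu>) n) / real W"
proof -
  define d where "d i = degree (cf_pq (\<alpha> k) i)" for i
  define N l where "N = cf_preperiod (\<alpha> k)" and "l = cf_period (\<alpha> k)"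
  define I where "I = {Suc N..<Suc N + l}"
  have per: "d (i + l) = d i" if "i \<ge> Suc N" for i
    using cf_period_indices_periodic(2)[OF cf_eventually_periodic_alpha[OF k], of i] that
    by (simp add: d_def N_def l_def)
  have hit': "\<exists>n. (\<Sum>i=1..n. d i) = \<mu> + i * W \<and> d (Suc n) = D \<mu>" if "\<mu> \<in> A" "i \<ge> 1" for \<mu> i
    using hit[OF that(1), of "i - 1"] that(2) by (simp add: hits_def d_def)
  have W: "W > 0"
    using A by auto
  define S F where "S = (\<Sum>j\<in>I. d j)" and "F = (\<Sum>j\<in>I. d j - n)"
  have "S > 0"
    unfolding S_def I_def
  proof (rule periodic_sum_pos[where d = d and l = l and N = N, OF per])
    show "l > 0"
      using cf_period_indices_periodic(1)[OF cf_eventually_periodic_alpha[OF k]] by (simp add: l_def)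
    fix B
    obtain \<mu> where "\<mu> \<in> A"
      using A by blast
    from hit'[OF this, of "Suc B"] obtain m where m: "(\<Sum>i=1..m. d i) = \<mu> + Suc B * W"
      by auto
    have "Suc B * 1 \<le> Suc B * W"
      using W by (intro mult_le_mono2) simp
    then have "B < Suc B * W"
      by (simp only: mult_1_right less_eq_Suc_le)
    then have "(\<Sum>i=1..m. d i) > B"
      unfolding m by (rule trans_less_add2)
    then show "\<exists>n. (\<Sum>i=1..n. d i) > B" ..
  qed
  have ratio: "escape_ratio (inverse w) [:0, 1:] k n = real F / real S"
    unfolding escape_ratio_def Let_def alpha_altdef
    by (simp add: F_def S_def I_def d_def N_def l_def cf_period_indices_def)
  have "S * (\<Sum>\<mu>\<in>A. D \<mu> - n) \<le> W * F"
    unfolding S_def F_def I_def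
    by (rule periodic_sum_ge[where d = d and l = l and N = N and \<phi> = "\<lambda>d. d - n",
        OF per A(1) hit' D])
  then have "real S * real (\<Sum>\<mu>\<in>A. D \<mu> - n) \<le> real W * real F"
    unfolding of_nat_mult[symmetric] of_nat_le_iff .
  then show "escape_ratio (inverse w) [:0, 1:] k n \<ge> real (\<Sum>\<mu>\<in>A. D \<mu> - n) / real W"
    using W \<open>S > 0\<close> by (simp only: ratio) (simp add: field_simps)
  have "S * (\<Sum>\<mu>\<in>A. min (D \<mu>) n) \<le> W * (\<Sum>j\<in>I. min (d j) n)"
    unfolding S_def I_def
    by (rule periodic_sum_ge[where d = d and l = l and N = N and \<phi> = "\<lambda>d. min d n",
        OF per A(1) hit' D])
  also have "(\<Sum>j\<in>I. min (d j) n) = S - F"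
  proof -
    have "F + (\<Sum>j\<in>I. min (d j) n) = S"
      unfolding F_def S_def sum.distrib[symmetric] by (intro sum.cong) auto
    then show ?thesis by simp
  qed
  finally have "real S * real (\<Sum>\<mu>\<in>A. min (D \<mu>) n) \<le> real W * real (S - F)"
    unfolding of_nat_mult[symmetric] of_nat_le_iff .
  moreover have "F \<le> S"
    unfolding F_def S_def by (intro sum_mono) simp
  ultimately show "escape_ratio (inverse w) [:0, 1:] k n \<le> 1 - real (\<Sum>\<mu>\<in>A. min (D \<mu>) n) / real W"
    using W \<open>S > 0\<close> by (simp only: ratio) (simp add: of_nat_diff field_simps)
qed

text \<open>For \<open>M = 2qi\<close>, \<open>U_M\<close> vanishes at 0 to order at least
  \<open>q > s\<close>, while \<open>T_M(0)\<close> is nonzero by the norm equation; so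
  \<open>t^s T_M\<close>, up to sign, is the part of lowest order.\<close>

lemma pell_T_exact_order:
  assumes s: "pell_T s = (pell_t ^ s :: 'a poly)" "odd s" and q: "pell_T q = (pell_t ^ q :: 'a poly)" "s < q"
  shows "\<exists>Q :: 'a poly. pell_T (s + 2 * q * i) = pell_t ^ s * Q \<and> poly Q 0 \<noteq> 0"
    and "s \<le> 2 * q * i \<Longrightarrow> \<exists>Q :: 'a poly. pell_T (2 * q * i - s) = pell_t ^ s * Q \<and> poly Q 0 \<noteq> 0"
proof -
  define M where "M = 2 * q * i"
  obtain V where V: "pell_U M = pell_t ^ q * (V :: 'a poly)"
    using pell_dvd_multiples(1)[OF q(1), of i] unfolding M_def by (elim dvdE)
  define V' where "V' = pell_D * (pell_t ^ (q - s) * (V * pell_U s))"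
  have tq: "pell_t ^ q = (pell_t ^ s * pell_t ^ (q - s) :: 'a poly)"
    using q(2) by (simp flip: power_add)
  have DU: "pell_D * (pell_U M * pell_U s) = pell_t ^ s * V'"
    unfolding V V'_def tq by (simp only: ac_simps)
  have t0: "poly pell_t (0 :: 'a) = 0"
    by (simp add: pell_t_def)
  have V'0: "poly V' 0 = 0"
    using q(2) by (simp add: V'_def t0)
  have "poly (pell_U M) (0 :: 'a) = 0"
    using q(2) by (simp add: V t0)
  then have "poly (pell_T M) (0 :: 'a) * poly (pell_T M) 0 = (- 1) ^ M"
    using arg_cong[OF pell_norm[of M, where ?'a = 'a], of "\<lambda>f. poly f 0"] by simp
  then have T0: "poly (pell_T M) (0 :: 'a) \<noteq> 0"
    by (intro notI) simp
  have "pell_T (s + M) = pell_t ^ s * (pell_T M + V')"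
    unfolding add.commute[of s] pell_T_add s(1) DU by (simp add: algebra_simps)
  then show "\<exists>Q :: 'a poly. pell_T (s + 2 * q * i) = pell_t ^ s * Q \<and> poly Q 0 \<noteq> 0"
    using T0 V'0 by (intro exI[of _ "pell_T M + V'"]) (simp add: M_def)
  assume "s \<le> 2 * q * i"
  then have "pell_T (M - s) = pell_t ^ s * (V' - pell_T M)"
    using pell_diff(1)[of s M, where ?'a = 'a] s DU by (simp add: M_def algebra_simps)
  then show "\<exists>Q :: 'a poly. pell_T (2 * q * i - s) = pell_t ^ s * Q \<and> poly Q 0 \<noteq> 0"
    using T0 V'0 by (intro exI[of _ "V' - pell_T M"]) (simp add: M_def)
qed

section \<open>Bounds for the escape ratio at a given exponent\<close>

lemma hits_large:
  assumes q: "pell_T q = (pell_t ^ q :: 'a poly)" and k: "k \<ge> 2" "k \<le> q"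
  shows "hits k (q - k + Suc i * (2 * q)) (k + 1)"
    and "hits k (2 * q + 1 - k + Suc i * (2 * q)) (k - 1)"
proof -
  have dvd: "pell_t ^ k dvd (pell_t ^ q :: 'a poly)"
    using k by (intro le_imp_power_dvd)
  have "pell_t ^ k dvd (pell_T (q + 2 * q * Suc i) :: 'a poly)"
    using dvd pell_dvd_multiples(2)[OF q] by (rule dvd_trans)
  then obtain Q where "pell_T (q + 2 * q * Suc i) = pell_t ^ k * (Q :: 'a poly)"
    by (elim dvdE)
  from hits_T[OF this, of 0] show "hits k (q - k + Suc i * (2 * q)) (k + 1)"
    using k by (simp add: algebra_simps)
  have "pell_t ^ k dvd (pell_U (2 * q * Suc (Suc i)) :: 'a poly)"
    using dvd pell_dvd_multiples(1)[OF q] by (rule dvd_trans)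
  from hits_U[OF this] show "hits k (2 * q + 1 - k + Suc i * (2 * q)) (k - 1)"
    using k by (simp add: algebra_simps)
qed

text \<open>The errors are \<open>t^(k-s) \<omega>^m\<close> for \<open>m\<close> at distance
  \<open>s\<close> on either side of a multiple of \<open>2q\<close>.\<close>

lemma hits_medium:
  assumes s: "pell_T s = (pell_t ^ s :: 'a poly)" "odd s" and q: "pell_T q = (pell_t ^ q :: 'a poly)" "s < q"
    and k: "s \<le> k" "k \<le> 2 * s"
  shows "hits k (Suc i * (2 * q)) (2 * s - k + 1)"
    and "hits k (2 * q - 2 * s + Suc i * (2 * q)) (2 * s - k + 1)"
proof -
  have r: "k - s \<le> s" "s + (k - s) = k" "s - (k - s) + 1 = 2 * s - k + 1"
    using k by auto
  obtain Q where "pell_T (s + 2 * q * Suc i) = pell_t ^ s * (Q :: 'a poly)" "poly Q 0 \<noteq> 0"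
    using pell_T_exact_order(1)[OF s q] by blast
  from hits_T[OF this(1) disjI2[OF this(2)] r(1)] show "hits k (Suc i * (2 * q)) (2 * s - k + 1)"
    unfolding r by (simp add: algebra_simps)
  have "s \<le> 2 * q * Suc (Suc i)"
    using q(2) by simp
  then obtain Q where "pell_T (2 * q * Suc (Suc i) - s) = pell_t ^ s * (Q :: 'a poly)" "poly Q 0 \<noteq> 0"
    using pell_T_exact_order(2)[OF s q] by blast
  from hits_T[OF this(1) disjI2[OF this(2)] r(1)]
  have "hits k (2 * q * Suc (Suc i) - s - s) (2 * s - k + 1)"
    unfolding r .
  moreover have "2 * q * Suc (Suc i) - s - s = 2 * q - 2 * s + Suc i * (2 * q)"
    using q(2) by (simp add: algebra_simps)
  ultimately show "hits k (2 * q - 2 * s + Suc i * (2 * q)) (2 * s - k + 1)"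
    by simp
qed

lemma escape_ratio_ge:
  assumes s: "pell_T s = (pell_t ^ s :: 'a poly)" "odd s" and q: "pell_T q = (pell_t ^ q :: 'a poly)" "3 * s \<le> q"
    and k: "s < k" "k \<le> q"
  shows "escape_ratio (inverse w) [:0, 1:] k n \<ge> (2 * real s - 2 * real n) / real q"
proof -
  have k2: "k \<ge> 2" "s < q" "s > 0"
    using s(2) k by (cases s; simp)+
  have "\<exists>A D. A \<subseteq> {..<2 * q} \<and> A \<noteq> {} \<and> (\<forall>\<mu>\<in>A. D \<mu> > 0 \<and> (\<forall>i. hits k (\<mu> + Suc i * (2 * q)) (D \<mu>)))
      \<and> 4 * real s - 4 * real n \<le> real (\<Sum>\<mu>\<in>A. D \<mu> - n)"
  proof (cases "k \<le> 2 * s")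
    case True
    \<comment> \<open>The degrees at these four positions add up to \<open>4s + 2\<close>, and each
      truncated subtraction loses at most \<open>n\<close>.\<close>
    define A where "A = {q - k, 2 * q + 1 - k, 0, 2 * q - 2 * s}"
    define D where "D = (\<lambda>\<mu>. if \<mu> = q - k then k + 1 else if \<mu> = 2 * q + 1 - k then k - 1 else 2 * s - k + 1)"
    have distinct: "q - k \<noteq> 2 * q + 1 - k" "q - k \<noteq> 0" "q - k \<noteq> 2 * q - 2 * s"
      "2 * q + 1 - k \<noteq> 0" "2 * q + 1 - k \<noteq> 2 * q - 2 * s" "2 * q - 2 * s \<noteq> 0"
      using True k q k2 by linarith+
    have "(\<Sum>\<mu>\<in>A. D \<mu> - n) = (k + 1 - n) + ((k - 1 - n) + ((2 * s - k + 1 - n) + (2 * s - k + 1 - n)))"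
      using distinct distinct[symmetric] by (simp add: A_def D_def)
    then have "4 * real s - 4 * real n \<le> real (\<Sum>\<mu>\<in>A. D \<mu> - n)"
      using True k2 by linarith
    moreover have "hits k (\<mu> + Suc i * (2 * q)) (D \<mu>)" if "\<mu> \<in> A" for \<mu> i
      using that distinct distinct[symmetric] hits_large[OF q(1) k2(1) k(2), of i]
        hits_medium[OF s q(1) k2(2) less_imp_le[OF k(1)] True, of i]
      by (auto simp: A_def D_def)
    moreover have "A \<subseteq> {..<2 * q}" "A \<noteq> {}" "\<forall>\<mu>\<in>A. D \<mu> > 0"
      using k k2 by (auto simp: A_def D_def)
    ultimately show ?thesis
      by blast
  next
    case False
    \<comment> \<open>For \<open>k > 2s\<close> the two large quotients alone have total degree
      \<open>2k > 4s\<close>.\<close>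
    define A where "A = {q - k, 2 * q + 1 - k}"
    define D where "D = (\<lambda>\<mu>. if \<mu> = q - k then k + 1 else k - 1)"
    have distinct: "q - k \<noteq> 2 * q + 1 - k"
      using k by linarith
    have "(\<Sum>\<mu>\<in>A. D \<mu> - n) = (k + 1 - n) + (k - 1 - n)"
      using distinct distinct[symmetric] by (simp add: A_def D_def)
    then have "4 * real s - 4 * real n \<le> real (\<Sum>\<mu>\<in>A. D \<mu> - n)"
      using False k2 by linarith
    moreover have "hits k (\<mu> + Suc i * (2 * q)) (D \<mu>)" if "\<mu> \<in> A" for \<mu> i
      using that distinct distinct[symmetric] hits_large[OF q(1) k2(1) k(2), of i]
      by (auto simp: A_def D_def)
    moreover have "A \<subseteq> {..<2 * q}" "A \<noteq> {}" "\<forall>\<mu>\<in>A. D \<mu> > 0"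
      using k k2 by (auto simp: A_def D_def)
    ultimately show ?thesis
      by blast
  qed
  then obtain A D where A: "A \<subseteq> {..<2 * q}" "A \<noteq> {}" "\<forall>\<mu>\<in>A. D \<mu> > 0 \<and> (\<forall>i. hits k (\<mu> + Suc i * (2 * q)) (D \<mu>))"
    and sum: "4 * real s - 4 * real n \<le> real (\<Sum>\<mu>\<in>A. D \<mu> - n)"
    by blast
  have "(2 * real s - 2 * real n) / real q = (4 * real s - 4 * real n) / real (2 * q)"
    using k2 by (simp add: field_simps)
  also have "\<dots> \<le> real (\<Sum>\<mu>\<in>A. D \<mu> - n) / real (2 * q)"
    by (intro divide_right_mono sum) simp
  also have "\<dots> \<le> escape_ratio (inverse w) [:0, 1:] k n"
    using k2 A by (intro escape_ratio_bounds(1)) auto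
  finally show ?thesis .
qed

text \<open>In a window of length \<open>2ps\<close>, quotients of degree 2 sit at the even
  positions inside suitable intervals of length \<open>s\<close>. Since \<open>n \<ge> 2\<close>,
  none of their degree escapes.\<close>

lemma escape_ratio_le:
  assumes s: "pell_T s = (pell_t ^ s :: 'a poly)" "odd s" "s > 1"
    and p: "CHAR('a) = p" "p > 2" and n: "n \<ge> 2"
  shows "escape_ratio (inverse w) [:0, 1:] (2 * s - 1) n
    \<le> 1 - (real p - 2) * (real s - 1) / (real p * real s)"
proof -
  \<comment> \<open>Residues of \<open>h\<close> modulo \<open>2p\<close> for which \<open>p\<close>
    divides neither \<open>h\<close> nor \<open>h + 1\<close>, as \<open>hits_block\<close>
    demands.\<close>
  define H where "H = {1..p - 2} \<union> {p + 1..2 * p - 2}"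
  define E where "E = {1..(s - 1) div 2}"
  \<comment> \<open>As \<open>s\<close> is odd, \<open>(h - 1) * s\<close> has the parity of
    \<open>h - 1\<close>; the offset, \<open>2e\<close> or \<open>2e - 1\<close>, makes the position
    even.\<close>
  define \<delta> where "\<delta> = (\<lambda>(h :: nat, e). 2 * e - (if odd h then 0 else 1 :: nat))"
  define g where "g = (\<lambda>(h, e). (h - 1) * s + \<delta> (h, e))"
  define A where "A = g ` (H \<times> E)"
  define W where "W = 2 * p * s"
  have \<delta>: "\<delta> (h, e) > 0" "\<delta> (h, e) < s" if "e \<in> E" for h e
    using that s(2,3) by (auto simp: E_def \<delta>_def elim!: oddE)
  have inj: "inj_on g (H \<times> E)"
  proof (rule inj_onI, clarify)
    fix h e h' e'
    assume *: "h \<in> H" "e \<in> E" "h' \<in> H" "e' \<in> E" "g (h, e) = g (h', e')"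
    have "g (h, e) div s = h - 1" "g (h', e') div s = h' - 1"
      using \<delta>[OF *(2)] \<delta>[OF *(4)] s(3) by (simp_all add: g_def)
    then have "h - 1 = h' - 1"
      using *(5) by simp
    then have h: "h = h'"
      using *(1,3) by (auto simp: H_def)
    then have "\<delta> (h, e) = \<delta> (h, e')"
      using *(5) by (simp add: g_def)
    then have "e = e'"
      using *(2,4) by (auto simp: \<delta>_def E_def split: if_splits)
    with h show "h = h' \<and> e = e'"
      by simp
  qed
  have "card H = 2 * (p - 2)"
    unfolding H_def using p(2) by (subst card_Un_disjoint) auto
  then have "card A = 2 * (p - 2) * ((s - 1) div 2)"
    unfolding A_def using card_image[OF inj] by (simp add: card_cartesian_product E_def)
  also have "\<dots> = (p - 2) * (2 * ((s - 1) div 2))"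
    by simp
  also have "2 * ((s - 1) div 2) = s - 1"
    using s(2) by simp
  finally have cardA: "card A = (p - 2) * (s - 1)" .
  have H: "1 \<le> h" "h < 2 * p" "\<not> p dvd h" "\<not> p dvd h + 1" if "h \<in> H" for h
  proof -
    have *: "\<not> p dvd m" if "0 < m mod p" for m
      using that by auto
    show "1 \<le> h" "h < 2 * p"
      using that p(2) by (auto simp: H_def)
    consider "1 \<le> h" "h + 1 < p" | h' where "h = p + h'" "1 \<le> h'" "h' + 1 < p"
      using \<open>h \<in> H\<close> p(2) by (auto simp: H_def le_iff_add)
    then have "0 < h mod p \<and> 0 < (h + 1) mod p"
    proof cases
      case 2
      then have "h + 1 = p + Suc h'"
        by simp
      with 2 show ?thesis
        by (simp only: mod_add_self1) simp
    qed auto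
    then show "\<not> p dvd h" "\<not> p dvd h + 1"
      using * by blast+
  qed
  have hit: "hits (2 * s - 1) (\<mu> + Suc i * W) 2 \<and> \<mu> < W" if "\<mu> \<in> A" for \<mu> i
  proof -
    obtain h e where he: "h \<in> H" "e \<in> E" "\<mu> = (h - 1) * s + \<delta> (h, e)"
      using \<open>\<mu> \<in> A\<close> by (auto simp: A_def g_def)
    \<comment> \<open>Moving by \<open>Suc i\<close> windows shifts \<open>h\<close> by a multiple
      of \<open>2p\<close>, which preserves its residue modulo \<open>p\<close>.\<close>
    define h' where "h' = h + Suc i * (2 * p)"
    have h1: "h = Suc (h - 1)"
      using H(1)[OF he(1)] by simp
    have "even \<mu>"
      using he(2) s(2) h1 by (auto simp: he(3) \<delta>_def E_def)
    have "\<mu> < h * s"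
      using \<delta>(2)[OF he(2), of h] by (subst h1) (simp add: he(3))
    also have "h * s \<le> W"
      using H(2)[OF he(1)] by (simp add: W_def)
    finally have "\<mu> < W" .
    have "h' - 1 = (h - 1) + Suc i * (2 * p)"
      using H(1)[OF he(1)] by (simp add: h'_def)
    then have "s * (h' - 1) = (h - 1) * s + Suc i * W"
      by (simp only: W_def distrib_left ac_simps)
    then have 1: "s * (h' - 1) < \<mu> + Suc i * W"
      using \<delta>(1)[OF he(2), of h] by (simp add: he(3))
    have "s * h' = h * s + Suc i * W"
      by (simp add: h'_def W_def algebra_simps)
    then have 2: "\<mu> + Suc i * W < s * h'"
      using \<open>\<mu> < h * s\<close> by simp
    have p_dvd: "p dvd Suc i * (2 * p)"
      by simp
    have "\<not> p dvd h'" "\<not> p dvd 1 + h'"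
      using H(3,4)[OF he(1)] p_dvd unfolding h'_def
      by (simp_all only: dvd_add_left_iff add.assoc[symmetric] add.commute[of 1] simp_thms)
    then have "of_nat h' \<noteq> (0 :: 'a)" "of_nat (1 + h') \<noteq> (0 :: 'a)"
      unfolding of_nat_eq_0_iff_char_dvd p(1) .
    with hits_block[OF s(1,2) _ 1 2] \<open>even \<mu>\<close> \<open>\<mu> < W\<close> show ?thesis
      by (simp add: W_def)
  qed
  have "escape_ratio (inverse w) [:0, 1:] (2 * s - 1) n
      \<le> 1 - real (\<Sum>\<mu>\<in>A. min 2 n) / real W"
  proof (rule escape_ratio_bounds(2)[where D = "\<lambda>_. 2"])
    show "A \<noteq> {}"
      using cardA p(2) s(3) by auto
  qed (use hit s(3) in auto)
  also have "(\<Sum>\<mu>\<in>A. min 2 n) = 2 * ((p - 2) * (s - 1))"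
    using n by (simp add: cardA min_def)
  also have "1 - real (2 * ((p - 2) * (s - 1))) / real W
      = 1 - (real p - 2) * (real s - 1) / (real p * real s)"
    using p(2) s(3) by (simp add: W_def of_nat_diff)
  finally show ?thesis .
qed

end

section \<open>Specialisation to \<open>Theta p\<close> and passage to the limit\<close>

lemma fls_nth_inverse_leading:
  fixes f :: "'a::field fls"
  assumes "f \<noteq> 0"
  shows "fls_nth (inverse f) (- fls_subdegree f) = inverse (fls_nth f (fls_subdegree f))"
proof -
  have "inverse f * f = 1"
    using assms by simp
  then have "fls_nth (inverse f) (- fls_subdegree f) * fls_nth f (fls_subdegree f) = 1"
    using fls_times_base[of "inverse f" f] by simp
  then show ?thesis
    by (metis inverse_unique mult.commute)
qed

lemma sqrt_pell_Theta:
  assumes "prime p" "odd p" "CARD('a::{field,finite}) = p"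
  shows "sqrt_pell (inverse (Theta p :: 'a fls))"
proof
  have p: "CHAR('a) = p" "p > 1"
    using CHAR_eq_CARD[OF assms(1,3)] prime_gt_1_nat[OF assms(1)] by simp_all
  have sd: "fls_subdegree (Theta p :: 'a fls) = 1"
    using p by (simp add: fls_subdegree_Theta)
  then have nz: "(Theta p :: 'a fls) \<noteq> 0"
    by auto
  show "inverse (Theta p :: 'a fls) ^ 2 = poly_to_tls pell_D"
    using Theta_square[OF assms(1,2) p(1)] nz by (simp add: pell_D_eq field_simps)
  show "fls_subdegree (inverse (Theta p :: 'a fls)) = - 1"
    using nz sd by simp
  show "fls_nth (inverse (Theta p :: 'a fls)) (- 1) = 1"
    using fls_nth_inverse_leading[OF nz] sd p by (simp add: Theta_nth_1)
  have "of_nat 2 \<noteq> (0 :: 'a)"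
    unfolding of_nat_eq_0_iff_char_dvd p(1)
    using assms(2) p(2) by (auto dest: dvd_imp_le elim!: oddE)
  then show "(2 :: 'a) \<noteq> 0"
    by simp
qed

lemma powers_bracket:
  fixes k p :: nat
  assumes "k > 1" "p > 1"
  obtains j where "p ^ j < k" "k \<le> p ^ Suc j"
proof -
  define m where "m = (LEAST m. k \<le> p ^ m)"
  have "k \<le> p ^ k"
    using power_gt_expt[of p k] assms(2) by simp
  then have m: "k \<le> p ^ m"
    unfolding m_def by (rule LeastI)
  have "m \<noteq> 0"
    using m assms(1) by (cases m) auto
  then obtain j where j: "m = Suc j"
    by (cases m) auto
  have "p ^ j < k"
    using not_less_Least[of j "\<lambda>m. k \<le> p ^ m"] j by (simp add: m_def)
  with m j that show thesis
    by simp
qed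

theorem theorem1p18:
  fixes p :: nat
  assumes "prime p" and "odd p"
    and "CARD('a::{field,finite}) = p"
  shows "exhibits_exactly_escape_of_mass (Theta p :: 'a fls) [:0, 1:] (2 / real p)"
proof -
  define \<Theta> where "\<Theta> = (Theta p :: 'a fls)"
  interpret sqrt_pell "inverse \<Theta>"
    unfolding \<Theta>_def by (rule sqrt_pell_Theta[OF assms])
  have inv: "inverse (inverse \<Theta>) = \<Theta>"
    by simp
  have char: "CHAR('a) = p"
    by (rule CHAR_eq_CARD[OF assms(1,3)])
  have p: "p > 2"
    using assms(1,2) prime_ge_2_nat[of p] by (cases "p = 2") auto
  have T: "pell_T (p ^ j) = (pell_t ^ (p ^ j) :: 'a poly)" for j
    by (rule pell_T_prime_power[of _ j]) (simp_all add: char assms(1))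
  have odd: "odd (p ^ j)" for j
    using assms(2) by simp
  define R where "R = (\<lambda>n k. ereal (escape_ratio \<Theta> [:0, 1:] k n))"
  have lower: "liminf (R n) \<ge> ereal (2 / real p)" for n
  proof -
    have "(\<lambda>k. 2 / real p - 2 * real n / real k) \<longlonglongrightarrow> 2 / real p - 0"
      by (intro tendsto_intros lim_const_over_n)
    then have "liminf (\<lambda>k. ereal (2 / real p - 2 * real n / real k)) = ereal (2 / real p)"
      by (intro lim_imp_Liminf) auto
    moreover have "liminf (\<lambda>k. ereal (2 / real p - 2 * real n / real k)) \<le> liminf (R n)"
    proof (rule Liminf_mono, rule eventually_sequentiallyI[of 2])
      fix k :: nat assume k: "k \<ge> 2"
      obtain j where j: "p ^ j < k" "k \<le> p ^ Suc j"
        using k p by (auto intro: powers_bracket[of k p])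
      have pos: "0 < real (p ^ Suc j)"
        using p by simp
      \<comment> \<open>The loss caused by \<open>n\<close> is bounded by \<open>2n/k\<close>, which
        vanishes as \<open>k\<close> grows with \<open>n\<close> fixed.\<close>
      have "2 * real n / real (p ^ Suc j) \<le> 2 * real n / real k"
        using j(2) k by (intro divide_left_mono mult_pos_pos pos) (auto simp del: power_Suc)
      then have "2 / real p - 2 * real n / real k \<le> 2 / real p - 2 * real n / real (p ^ Suc j)"
        by simp
      also have "\<dots> = (2 * real (p ^ j) - 2 * real n) / real (p ^ Suc j)"
        using p by (simp add: field_simps)
      also have "\<dots> \<le> escape_ratio \<Theta> [:0, 1:] k n"
        using escape_ratio_ge[OF T odd T _ j, of n] p unfolding inv by simp
      finally show "ereal (2 / real p - 2 * real n / real k) \<le> R n k"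
        by (simp add: R_def)
    qed
    ultimately show ?thesis
      by simp
  qed
  have upper: "liminf (R n) \<le> ereal (2 / real p)" if n: "n \<ge> 2" for n
  proof -
    \<comment> \<open>These are the exponents \<open>k = 2s - 1\<close> with
      \<open>s = p^(j+1)\<close>; using \<open>Suc j\<close> keeps \<open>s > 1\<close>. A
      subsequence suffices to bound a liminf from above.\<close>
    define K where "K = (\<lambda>j. 2 * p ^ Suc j - 1)"
    have mono: "strict_mono K"
    proof (rule strict_monoI_Suc)
      fix j
      have "p ^ Suc j < p ^ Suc (Suc j)" "p ^ Suc j > 0"
        using p by auto
      then show "K j < K (Suc j)"
        unfolding K_def by linarith
    qed
    have inverse_tendsto: "(\<lambda>j. inverse (real p ^ Suc j)) \<longlonglongrightarrow> 0"
      using LIMSEQ_inverse_realpow_zero[of "real p"] p by (intro LIMSEQ_Suc) simp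
    have "(\<lambda>j. 1 - (real p - 2) / real p * (1 - inverse (real p ^ Suc j)))
        \<longlonglongrightarrow> 1 - (real p - 2) / real p * (1 - 0)"
      by (intro tendsto_intros inverse_tendsto)
    also have "1 - (real p - 2) / real p * (1 - 0) = 2 / real p"
      using p by (simp add: field_simps)
    finally have lim: "liminf (\<lambda>j. ereal (1 - (real p - 2) / real p * (1 - inverse (real p ^ Suc j))))
        = ereal (2 / real p)"
      by (intro lim_imp_Liminf) auto
    have "liminf (R n) \<le> liminf (R n \<circ> K)"
      by (rule liminf_subseq_mono[OF mono])
    also have "\<dots> \<le> liminf (\<lambda>j. ereal (1 - (real p - 2) / real p * (1 - inverse (real p ^ Suc j))))"
    proof (rule Liminf_mono, rule always_eventually, rule allI)
      fix j
      have "p ^ Suc j > 1"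
        using p by (intro one_less_power) auto
      then have "escape_ratio \<Theta> [:0, 1:] (K j) n
          \<le> 1 - (real p - 2) * (real (p ^ Suc j) - 1) / (real p * real (p ^ Suc j))"
        using escape_ratio_le[OF T odd _ char p n, of "Suc j"] unfolding inv K_def by blast
      also have "\<dots> = 1 - (real p - 2) / real p * (1 - inverse (real p ^ Suc j))"
        using p by (simp add: field_simps)
      finally show "(R n \<circ> K) j \<le> ereal (1 - (real p - 2) / real p * (1 - inverse (real p ^ Suc j)))"
        by (simp add: R_def)
    qed
    finally show ?thesis
      using lim by simp
  qed
  \<comment> \<open>The inner liminf equals \<open>2/p\<close> from \<open>n = 2\<close> on, so the
    outer sequence is eventually constant.\<close>
  have "(\<lambda>n. liminf (R n)) \<longlonglongrightarrow> ereal (2 / real p)"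
    by (rule tendsto_eventually, rule eventually_sequentiallyI[of 2])
      (use lower upper in \<open>blast intro: antisym\<close>)
  then have lim: "(\<lambda>n. liminf (\<lambda>k. ereal (escape_ratio \<Theta> [:0, 1:] k n))) \<longlonglongrightarrow> ereal (2 / real p)"
    by (simp add: R_def)
  have "exhibits_escape_of_mass \<Theta> [:0, 1:] (2 / real p)"
    unfolding exhibits_escape_of_mass_def using lim p by auto
  moreover have "c \<le> 2 / real p" if c: "exhibits_escape_of_mass \<Theta> [:0, 1:] c" for c
  proof -
    obtain L where L: "(\<lambda>n. liminf (\<lambda>k. ereal (escape_ratio \<Theta> [:0, 1:] k n))) \<longlonglongrightarrow> L" "ereal c \<le> L"
      using c unfolding exhibits_escape_of_mass_def by blast
    have "L = ereal (2 / real p)"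
      using L(1) lim by (rule LIMSEQ_unique)
    with L(2) show ?thesis
      by simp
  qed
  ultimately show ?thesis
    unfolding exhibits_exactly_escape_of_mass_def \<Theta>_def by blast
qed

end
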